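(* Let $R=\mathbb{F}_3[X]$ and $\pi=X$. Let $C_3:=(R/\pi^2)(e\xrightarrow{a}f)$ be the path algebra over $R/\pi^2$ of the quiver with two vertices $e,f$ and one arrow $a:e\to f$. Then the Heller operator $\Omega:\underline{\mathrm{mod}}\text{-}C_3\to\underline{\mathrm{mod}}\text{-}C_3$ does not have a right adjoint.
   Context: $\mathrm{mod}\text{-}C_3$ is the category of finitely generated right $C_3$-modules. The element $a$ lies in $eC_3f$; thus an object of $\mathrm{mod}\text{-}C_3$ amounts to a morphism $X\to Y$ of finitely generated $R/\pi^2$-modules, and a morphism to a commutative square. For a noetherian ring $C$, $\underline{\mathrm{mod}}\text{-}C$ is the factor category of $\mathrm{mod}\text{-}C$ modulo the full additive subcategory of projective modules (morphisms are identified if their difference factors over a projective module). The Heller operator $\Omega:\underline{\mathrm{mod}}\text{-}C\to\underline{\mathrm{mod}}\text{-}C$ is given on objects by choosing for each $X$ a short exact sequence $0\to\Omega X\to \mathrm{P}X\to X\to0$ with $\mathrm{P}X$ finitely generated projective; for $f:X\to Y$ one chooses a morphism $(f',\hat f,f)$ between the chosen sequences and sets $\Omega[f]:=[f']$. It is well defined up to isomorphism of functors. *)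

theory Defs
  imports "HOL-Algebra.Algebra" "HOL-Number_Theory.Residues"
begin

no_notation var (\<open>X\<index>\<close>)

section \<open>Path algebras\<close>

record ('v, 'a) quiver =
  vertices :: "'v set"
  arrows :: "'a set"
  src :: "'a \<Rightarrow> 'v"
  tgt :: "'a \<Rightarrow> 'v"

primrec path_from :: "('v, 'a) quiver \<Rightarrow> 'v \<Rightarrow> 'a list \<Rightarrow> bool" where
  "path_from Q v [] \<longleftrightarrow> v \<in> vertices Q"
| "path_from Q v (x # xs) \<longleftrightarrow>
     v \<in> vertices Q \<and> x \<in> arrows Q \<and> src Q x = v \<and> path_from Q (tgt Q x) xs"

primrec path_end :: "('v, 'a) quiver \<Rightarrow> 'v \<Rightarrow> 'a list \<Rightarrow> 'v" where
  "path_end Q v [] = v"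
| "path_end Q v (x # xs) = path_end Q (tgt Q x) xs"

text \<open>A path is a start vertex with a list of arrows; the list is empty for the trivial paths.\<close>

definition paths :: "('v, 'a) quiver \<Rightarrow> ('v \<times> 'a list) set" where
  "paths Q = {(v, xs). path_from Q v xs}"

text \<open>
  The pairs of composable paths with composite \<open>p\<close>. Paths are composed from left to right,
  so that an arrow \<open>a\<close> from \<open>e\<close> to \<open>f\<close> satisfies \<open>a = e a f\<close>.
\<close>

definition path_splits ::
  "('v, 'a) quiver \<Rightarrow> 'v \<times> 'a list \<Rightarrow> (('v \<times> 'a list) \<times> ('v \<times> 'a list)) set" where
  "path_splits Q p =
     {(q, r). q \<in> paths Q \<and> r \<in> paths Q \<and> path_end Q (fst q) (snd q) = fst r \<and>
              (fst q, snd q @ snd r) = p}"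

text \<open>
  An element of the path algebra is given by its coefficients; they are set to zero outside
  the set of paths. The unit is the sum of the trivial paths, so a quiver with finitely many
  vertices is intended.
\<close>

definition path_algebra ::
  "('k, 'm) ring_scheme \<Rightarrow> ('v, 'a) quiver \<Rightarrow> ('v \<times> 'a list \<Rightarrow> 'k) ring" where
  "path_algebra K Q =
     \<lparr>carrier = {x. (\<forall>p. x p \<in> carrier K) \<and> (\<forall>p. p \<notin> paths Q \<longrightarrow> x p = \<zero>\<^bsub>K\<^esub>)
                    \<and> finite {p. x p \<noteq> \<zero>\<^bsub>K\<^esub>}},
      monoid.mult = (\<lambda>x y p. \<Oplus>\<^bsub>K\<^esub>s \<in> path_splits Q p. x (fst s) \<otimes>\<^bsub>K\<^esub> y (snd s)),
      monoid.one = (\<lambda>p. if p \<in> paths Q \<and> snd p = [] then \<one>\<^bsub>K\<^esub> else \<zero>\<^bsub>K\<^esub>),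
      ring.zero = (\<lambda>p. \<zero>\<^bsub>K\<^esub>),
      ring.add = (\<lambda>x y p. x p \<oplus>\<^bsub>K\<^esub> y p)\<rparr>"

datatype vertex = Vertex_e | Vertex_f

datatype arrow = Arrow_a

definition quiver_e_to_f :: "(vertex, arrow) quiver" where
  "quiver_e_to_f =
     \<lparr>vertices = {Vertex_e, Vertex_f}, arrows = {Arrow_a},
      src = (\<lambda>_. Vertex_e), tgt = (\<lambda>_. Vertex_f)\<rparr>"

definition ring_R :: "int list ring" where
  "ring_R = univ_poly (residue_ring 3) (carrier (residue_ring 3))"

definition elem_pi :: "int list" where
  "elem_pi = var (residue_ring 3)"

definition ring_R_mod_pi2 :: "int list set ring" where
  "ring_R_mod_pi2 = ring_R Quot (PIdl\<^bsub>ring_R\<^esub> (elem_pi [^]\<^bsub>ring_R\<^esub> (2::nat)))"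

type_synonym c3 = "vertex \<times> arrow list \<Rightarrow> int list set"

definition C3 :: "c3 ring" where
  "C3 = path_algebra ring_R_mod_pi2 quiver_e_to_f"

section \<open>Right modules\<close>

text \<open>
  The fields \<open>mult\<close> and \<open>one\<close> inherited from the record of rings play no role.
\<close>

record ('c, 'u) rmodule = "'u ring" +
  ract :: "'u \<Rightarrow> 'c \<Rightarrow> 'u" (infixl \<open>\<lhd>\<index>\<close> 70)

locale right_module = C?: ring C + M?: abelian_group M
  for C :: "('c, 'r) ring_scheme" (structure) and M :: "('c, 'u, 's) rmodule_scheme" (structure) +
  assumes ract_closed: "\<lbrakk>m \<in> carrier M; r \<in> carrier C\<rbrakk> \<Longrightarrow> m \<lhd>\<^bsub>M\<^esub> r \<in> carrier M"
    and ract_add_left: "\<lbrakk>m \<in> carrier M; n \<in> carrier M; r \<in> carrier C\<rbrakk> \<Longrightarrow>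
          (m \<oplus>\<^bsub>M\<^esub> n) \<lhd>\<^bsub>M\<^esub> r = m \<lhd>\<^bsub>M\<^esub> r \<oplus>\<^bsub>M\<^esub> n \<lhd>\<^bsub>M\<^esub> r"
    and ract_add_right: "\<lbrakk>m \<in> carrier M; r \<in> carrier C; s \<in> carrier C\<rbrakk> \<Longrightarrow>
          m \<lhd>\<^bsub>M\<^esub> (r \<oplus>\<^bsub>C\<^esub> s) = m \<lhd>\<^bsub>M\<^esub> r \<oplus>\<^bsub>M\<^esub> m \<lhd>\<^bsub>M\<^esub> s"
    and ract_mult: "\<lbrakk>m \<in> carrier M; r \<in> carrier C; s \<in> carrier C\<rbrakk> \<Longrightarrow>
          m \<lhd>\<^bsub>M\<^esub> (r \<otimes>\<^bsub>C\<^esub> s) = m \<lhd>\<^bsub>M\<^esub> r \<lhd>\<^bsub>M\<^esub> s"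
    and ract_one: "m \<in> carrier M \<Longrightarrow> m \<lhd>\<^bsub>M\<^esub> \<one>\<^bsub>C\<^esub> = m"

definition rsubmodule :: "('c, 'r) ring_scheme \<Rightarrow> 'u set \<Rightarrow> ('c, 'u) rmodule \<Rightarrow> bool" where
  "rsubmodule C U M \<longleftrightarrow>
     U \<subseteq> carrier M \<and> \<zero>\<^bsub>M\<^esub> \<in> U \<and> (\<forall>m\<in>U. \<forall>n\<in>U. m \<oplus>\<^bsub>M\<^esub> n \<in> U) \<and>
     (\<forall>m\<in>U. \<forall>r\<in>carrier C. m \<lhd>\<^bsub>M\<^esub> r \<in> U)"

definition finitely_generated :: "('c, 'r) ring_scheme \<Rightarrow> ('c, 'u) rmodule \<Rightarrow> bool" where
  "finitely_generated C M \<longleftrightarrow>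
     (\<exists>S. finite S \<and> S \<subseteq> carrier M \<and> (\<forall>U. rsubmodule C U M \<and> S \<subseteq> U \<longrightarrow> U = carrier M))"

text \<open>Morphisms are extensional functions, so that equality of morphisms is equality in HOL.\<close>

definition rhom ::
  "('c, 'r) ring_scheme \<Rightarrow> ('c, 'u) rmodule \<Rightarrow> ('c, 'u) rmodule \<Rightarrow> ('u \<Rightarrow> 'u) set" where
  "rhom C M N =
     {h \<in> carrier M \<rightarrow>\<^sub>E carrier N.
        (\<forall>x\<in>carrier M. \<forall>y\<in>carrier M. h (x \<oplus>\<^bsub>M\<^esub> y) = h x \<oplus>\<^bsub>N\<^esub> h y) \<and>
        (\<forall>x\<in>carrier M. \<forall>r\<in>carrier C. h (x \<lhd>\<^bsub>M\<^esub> r) = h x \<lhd>\<^bsub>N\<^esub> r)}"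

text \<open>
  Lifting property against all surjections between right modules with carrier in \<open>'u\<close>,
  not only finitely generated ones.
\<close>

definition projective :: "('c, 'r) ring_scheme \<Rightarrow> ('c, 'u) rmodule \<Rightarrow> bool" where
  "projective C P \<longleftrightarrow>
     right_module C P \<and>
     (\<forall>M N g h. right_module C M \<and> right_module C N \<and>
        g \<in> rhom C M N \<and> g ` carrier M = carrier N \<and> h \<in> rhom C P N \<longrightarrow>
        (\<exists>k \<in> rhom C P M. compose (carrier P) g k = h))"

section \<open>Categories, functors, adjoints\<close>

text \<open>
  Hom-sets of different pairs of objects need not be disjoint, so composition, and the action of
  a functor on morphisms, carry the objects as arguments. \<open>cmp X Y Z g f\<close> is the composite of
  \<open>f : X \<rightarrow> Y\<close> followed by \<open>g : Y \<rightarrow> Z\<close>.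
\<close>

record ('o, 'm) cat =
  Obj :: "'o set"
  Hom :: "'o \<Rightarrow> 'o \<Rightarrow> 'm set"
  ident :: "'o \<Rightarrow> 'm"
  cmp :: "'o \<Rightarrow> 'o \<Rightarrow> 'o \<Rightarrow> 'm \<Rightarrow> 'm \<Rightarrow> 'm"

record ('o, 'm, 'p, 'n) cat_map =
  on_obj :: "'o \<Rightarrow> 'p"
  on_mor :: "'o \<Rightarrow> 'o \<Rightarrow> 'm \<Rightarrow> 'n"

definition is_functor :: "('o, 'm) cat \<Rightarrow> ('p, 'n) cat \<Rightarrow> ('o, 'm, 'p, 'n) cat_map \<Rightarrow> bool" where
  "is_functor A B F \<longleftrightarrow>
     (\<forall>X\<in>Obj A. on_obj F X \<in> Obj B) \<and>
     (\<forall>X\<in>Obj A. \<forall>Y\<in>Obj A. \<forall>f\<in>Hom A X Y. on_mor F X Y f \<in> Hom B (on_obj F X) (on_obj F Y)) \<and>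
     (\<forall>X\<in>Obj A. on_mor F X X (ident A X) = ident B (on_obj F X)) \<and>
     (\<forall>X\<in>Obj A. \<forall>Y\<in>Obj A. \<forall>Z\<in>Obj A. \<forall>f\<in>Hom A X Y. \<forall>g\<in>Hom A Y Z.
        on_mor F X Z (cmp A X Y Z g f) =
        cmp B (on_obj F X) (on_obj F Y) (on_obj F Z) (on_mor F Y Z g) (on_mor F X Y f))"

text \<open>
  \<open>G : B \<rightarrow> A\<close> is right adjoint to \<open>F : A \<rightarrow> B\<close> if there are bijections
  \<open>\<phi> X Y : Hom B (F X) Y \<rightarrow> Hom A X (G Y)\<close>, natural in \<open>X\<close> and \<open>Y\<close>.
  If \<open>A\<close> and \<open>B\<close> are categories, then functoriality of \<open>F\<close> already follows from naturality,
  so it is not required separately.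
\<close>

definition is_right_adjoint ::
  "('o, 'm) cat \<Rightarrow> ('p, 'n) cat \<Rightarrow> ('o, 'm, 'p, 'n) cat_map \<Rightarrow> ('p, 'n, 'o, 'm) cat_map \<Rightarrow> bool"
  where
  "is_right_adjoint A B F G \<longleftrightarrow>
     is_functor B A G \<and>
     (\<exists>\<phi>. (\<forall>X\<in>Obj A. \<forall>Y\<in>Obj B.
             bij_betw (\<phi> X Y) (Hom B (on_obj F X) Y) (Hom A X (on_obj G Y))) \<and>
          (\<forall>X\<in>Obj A. \<forall>X'\<in>Obj A. \<forall>Y\<in>Obj B. \<forall>Y'\<in>Obj B.
             \<forall>f\<in>Hom A X' X. \<forall>g\<in>Hom B Y Y'. \<forall>h\<in>Hom B (on_obj F X) Y.
               \<phi> X' Y' (cmp B (on_obj F X') Y Y' g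
                          (cmp B (on_obj F X') (on_obj F X) Y h (on_mor F X' X f))) =
               cmp A X' (on_obj G Y) (on_obj G Y') (on_mor G Y Y' g)
                 (cmp A X' X (on_obj G Y) (\<phi> X Y h) f)))"

definition has_right_adjoint ::
  "('o, 'm) cat \<Rightarrow> ('p, 'n) cat \<Rightarrow> ('o, 'm, 'p, 'n) cat_map \<Rightarrow> bool" where
  "has_right_adjoint A B F \<longleftrightarrow> (\<exists>G. is_right_adjoint A B F G)"

section \<open>Finitely generated modules, the stable category and the Heller operator\<close>

text \<open>
  The underlying sets of modules are subsets of a fixed type \<open>'u\<close>. If the ring is finite and
  \<open>'u\<close> is infinite, then every finitely generated module has an isomorphic copy in \<open>'u\<close>.
\<close>

definition fg_modules :: "('c, 'r) ring_scheme \<Rightarrow> ('c, 'u) rmodule set" where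
  "fg_modules C = {M. right_module C M \<and> finitely_generated C M}"

definition mod_cat :: "('c, 'r) ring_scheme \<Rightarrow> (('c, 'u) rmodule, 'u \<Rightarrow> 'u) cat" where
  "mod_cat C =
     \<lparr>Obj = fg_modules C,
      Hom = rhom C,
      ident = (\<lambda>X. \<lambda>x\<in>carrier X. x),
      cmp = (\<lambda>X Y Z g f. compose (carrier X) g f)\<rparr>"

definition stable_rel ::
  "('c, 'r) ring_scheme \<Rightarrow> ('c, 'u) rmodule \<Rightarrow> ('c, 'u) rmodule \<Rightarrow> (('u \<Rightarrow> 'u) \<times> ('u \<Rightarrow> 'u)) set"
  where
  "stable_rel C X Y =
     {(f, g). f \<in> rhom C X Y \<and> g \<in> rhom C X Y \<and>
        (\<exists>P \<in> fg_modules C. projective C P \<and>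
           (\<exists>u \<in> rhom C X P. \<exists>v \<in> rhom C P Y.
              \<forall>x\<in>carrier X. f x \<ominus>\<^bsub>Y\<^esub> g x = v (u x)))}"

abbreviation stable_class ::
  "('c, 'r) ring_scheme \<Rightarrow> ('c, 'u) rmodule \<Rightarrow> ('c, 'u) rmodule \<Rightarrow> ('u \<Rightarrow> 'u) \<Rightarrow> ('u \<Rightarrow> 'u) set"
  where "stable_class C X Y f \<equiv> stable_rel C X Y `` {f}"

definition stable_cat :: "('c, 'r) ring_scheme \<Rightarrow> (('c, 'u) rmodule, ('u \<Rightarrow> 'u) set) cat" where
  "stable_cat C =
     \<lparr>Obj = fg_modules C,
      Hom = (\<lambda>X Y. rhom C X Y // stable_rel C X Y),
      ident = (\<lambda>X. stable_class C X X (ident (mod_cat C) X)),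
      cmp = (\<lambda>X Y Z \<gamma> \<phi>. \<Union>g\<in>\<gamma>. \<Union>f\<in>\<phi>. stable_class C X Z (cmp (mod_cat C) X Y Z g f))\<rparr>"

definition short_exact ::
  "('c, 'r) ring_scheme \<Rightarrow> ('c, 'u) rmodule \<Rightarrow> ('c, 'u) rmodule \<Rightarrow> ('c, 'u) rmodule \<Rightarrow>
   ('u \<Rightarrow> 'u) \<Rightarrow> ('u \<Rightarrow> 'u) \<Rightarrow> bool" where
  "short_exact C X' X X'' i p \<longleftrightarrow>
     i \<in> rhom C X' X \<and> p \<in> rhom C X X'' \<and>
     inj_on i (carrier X') \<and> i ` carrier X' = {x \<in> carrier X. p x = \<zero>\<^bsub>X''\<^esub>} \<and>
     p ` carrier X = carrier X''"

text \<open>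
  \<open>\<Omega>\<close> is a Heller operator if it arises from some choice of short exact sequences
  \<open>0 \<rightarrow> \<Omega> X \<rightarrow> P X \<rightarrow> X \<rightarrow> 0\<close> and of morphisms \<open>(f', f'', f)\<close> between them.
\<close>

definition heller_operator ::
  "('c, 'r) ring_scheme \<Rightarrow>
   (('c, 'u) rmodule, ('u \<Rightarrow> 'u) set, ('c, 'u) rmodule, ('u \<Rightarrow> 'u) set) cat_map \<Rightarrow> bool" where
  "heller_operator C \<Omega> \<longleftrightarrow>
     (\<exists>P i p.
        (\<forall>X\<in>fg_modules C.
           on_obj \<Omega> X \<in> fg_modules C \<and> P X \<in> fg_modules C \<and> projective C (P X) \<and>
           short_exact C (on_obj \<Omega> X) (P X) X (i X) (p X)) \<and>
        (\<forall>X\<in>fg_modules C. \<forall>Y\<in>fg_modules C. \<forall>f\<in>rhom C X Y.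
           \<exists>f' \<in> rhom C (on_obj \<Omega> X) (on_obj \<Omega> Y). \<exists>f'' \<in> rhom C (P X) (P Y).
             (\<forall>x\<in>carrier (on_obj \<Omega> X). f'' (i X x) = i Y (f' x)) \<and>
             (\<forall>x\<in>carrier (P X). f (p X x) = p Y (f'' x)) \<and>
             on_mor \<Omega> X Y (stable_class C X Y f) =
               stable_class C (on_obj \<Omega> X) (on_obj \<Omega> Y) f'))"

end

theory Submission
  imports Defs
begin

text \<open>
  Write a module as a morphism \<open>X \<rightarrow> Y\<close> of modules over \<open>k[\<epsilon>] = R/\<pi>\<^sup>2\<close>, and put \<open>U = (0 \<rightarrow> k)\<close>,
  \<open>V = (k = k)\<close> and \<open>Q = (k[\<epsilon>] \<rightarrow> k[\<epsilon>])\<close>, the last one given by multiplication with \<open>\<epsilon>\<close>.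
  Suppose that \<open>\<Omega>\<close> has a right adjoint \<open>G\<close>, and let \<open>Y = G U\<close>, so that stably \<open>Hom(X, Y)\<close> is in bijection
  with \<open>Hom(\<Omega> X, U)\<close> for all \<open>X\<close>. Then \<open>Hom(Q, Y) = 0\<close> since \<open>\<Omega> Q\<close> is projective, \<open>Hom(V, Y) = 0\<close> since
  every morphism from \<open>\<Omega> V = V\<close> to \<open>U\<close> is stably zero, and \<open>Hom(U, Y) \<noteq> 0\<close> since \<open>\<Omega> U = U\<close>.
  But \<open>Hom(Q, Y) = 0\<close> makes every morphism \<open>U \<rightarrow> Y\<close> stably equal to one that factors over \<open>U \<rightarrow> V\<close>,
  and is thus zero because \<open>Hom(V, Y) = 0\<close>: a contradiction. Identities such as \<open>\<Omega> U = U\<close> hold up to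
  projective summands.
\<close>

section \<open>Right modules and linear maps\<close>

text \<open>The choice of test modules comes from the maps Q \<rightarrow> U \<rightarrow> V. Stably
  V is a weak cokernel of Q \<rightarrow> U: the composite is null, and a morphism out of U that is
  null on Q factors over V. A functor with a right adjoint would respect this, but applying \<Omega>
  turns it into 0 \<rightarrow> U \<rightarrow> V, and the identity of U would then factor stably
  over V, although Hom(V, U) = 0. An adjunction supplies bijections of hom-sets, so the vanishing of
  a stable hom-set is expressed as having exactly one element, which any bijection preserves. The
  main obstacle to a direct formalisation is one of types: modules have carriers in
  \<open>'u\<close>, whereas the ring, its right ideals and free modules do not. All the modules
  that have to be moved are finite, so copies in \<open>'u\<close> exist. For the same reason the
  test modules are described by a generator and its annihilator, and syzygies are compared by
  explicit maps on elements.\<close>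

lemma (in abelian_group) minus_eq_zero_iff:
  "\<lbrakk>x \<in> carrier G; y \<in> carrier G\<rbrakk> \<Longrightarrow> x \<ominus> y = \<zero> \<longleftrightarrow> x = y"
  by (metis a_inv_closed minus_eq minus_equality minus_minus r_neg)

context right_module
begin

lemma zero_ract: "r \<in> carrier C \<Longrightarrow> \<zero>\<^bsub>M\<^esub> \<lhd>\<^bsub>M\<^esub> r = \<zero>\<^bsub>M\<^esub>"
  using ract_add_left[of "\<zero>\<^bsub>M\<^esub>" "\<zero>\<^bsub>M\<^esub>" r] ract_closed[of "\<zero>\<^bsub>M\<^esub>" r] by simp

lemma ract_zero: "m \<in> carrier M \<Longrightarrow> m \<lhd>\<^bsub>M\<^esub> \<zero>\<^bsub>C\<^esub> = \<zero>\<^bsub>M\<^esub>"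
  using ract_add_right[of m "\<zero>\<^bsub>C\<^esub>" "\<zero>\<^bsub>C\<^esub>"] ract_closed[of m "\<zero>\<^bsub>C\<^esub>"] by simp

lemma ract_a_inv_left: "\<lbrakk>m \<in> carrier M; r \<in> carrier C\<rbrakk> \<Longrightarrow> (\<ominus>\<^bsub>M\<^esub> m) \<lhd>\<^bsub>M\<^esub> r = \<ominus>\<^bsub>M\<^esub> (m \<lhd>\<^bsub>M\<^esub> r)"
  using ract_add_left[of "\<ominus>\<^bsub>M\<^esub> m" m r] ract_closed[of m r] ract_closed[of "\<ominus>\<^bsub>M\<^esub> m" r] zero_ract[of r]
  by (metis M.a_inv_closed M.l_neg M.minus_equality)

lemma ract_a_inv_right: "\<lbrakk>m \<in> carrier M; r \<in> carrier C\<rbrakk> \<Longrightarrow> m \<lhd>\<^bsub>M\<^esub> (\<ominus>\<^bsub>C\<^esub> r) = \<ominus>\<^bsub>M\<^esub> (m \<lhd>\<^bsub>M\<^esub> r)"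
  using ract_add_right[of m "\<ominus>\<^bsub>C\<^esub> r" r] ract_closed[of m r] ract_closed[of m "\<ominus>\<^bsub>C\<^esub> r"] ract_zero[of m]
  by (metis C.a_inv_closed C.l_neg M.minus_equality)

lemma ract_minus_left:
  "\<lbrakk>m \<in> carrier M; n \<in> carrier M; r \<in> carrier C\<rbrakk> \<Longrightarrow> (m \<ominus>\<^bsub>M\<^esub> n) \<lhd>\<^bsub>M\<^esub> r = m \<lhd>\<^bsub>M\<^esub> r \<ominus>\<^bsub>M\<^esub> n \<lhd>\<^bsub>M\<^esub> r"
  by (simp add: a_minus_def ract_add_left ract_a_inv_left)

lemma ract_minus_right:
  "\<lbrakk>m \<in> carrier M; r \<in> carrier C; s \<in> carrier C\<rbrakk> \<Longrightarrow> m \<lhd>\<^bsub>M\<^esub> (r \<ominus>\<^bsub>C\<^esub> s) = m \<lhd>\<^bsub>M\<^esub> r \<ominus>\<^bsub>M\<^esub> m \<lhd>\<^bsub>M\<^esub> s"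
  by (simp add: a_minus_def ract_add_right ract_a_inv_right)


end

text \<open>Unlike in \<open>rhom\<close>, source and target may have different carrier types and
  functions are not cut off outside the carrier. Maps between the ring, free modules and modules in
  \<open>'u\<close> can thus be composed freely; \<open>rhom_restrict\<close> leads back to
  \<open>rhom\<close>.\<close>

definition rlin ::
  "('c, 'r) ring_scheme \<Rightarrow> ('c, 's) rmodule \<Rightarrow> ('c, 't) rmodule \<Rightarrow> ('s \<Rightarrow> 't) \<Rightarrow> bool" where
  "rlin C M N h \<longleftrightarrow> h \<in> carrier M \<rightarrow> carrier N \<and>
     (\<forall>x\<in>carrier M. \<forall>y\<in>carrier M. h (x \<oplus>\<^bsub>M\<^esub> y) = h x \<oplus>\<^bsub>N\<^esub> h y) \<and>
     (\<forall>x\<in>carrier M. \<forall>r\<in>carrier C. h (x \<lhd>\<^bsub>M\<^esub> r) = h x \<lhd>\<^bsub>N\<^esub> r)"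

lemma rlinI:
  assumes "\<And>x. x \<in> carrier M \<Longrightarrow> h x \<in> carrier N"
    and "\<And>x y. \<lbrakk>x \<in> carrier M; y \<in> carrier M\<rbrakk> \<Longrightarrow> h (x \<oplus>\<^bsub>M\<^esub> y) = h x \<oplus>\<^bsub>N\<^esub> h y"
    and "\<And>x r. \<lbrakk>x \<in> carrier M; r \<in> carrier C\<rbrakk> \<Longrightarrow> h (x \<lhd>\<^bsub>M\<^esub> r) = h x \<lhd>\<^bsub>N\<^esub> r"
  shows "rlin C M N h"
  using assms by (auto simp: rlin_def)

lemma rlinD:
  assumes "rlin C M N h"
  shows rlin_closed: "x \<in> carrier M \<Longrightarrow> h x \<in> carrier N"
    and rlin_add: "\<lbrakk>x \<in> carrier M; y \<in> carrier M\<rbrakk> \<Longrightarrow> h (x \<oplus>\<^bsub>M\<^esub> y) = h x \<oplus>\<^bsub>N\<^esub> h y"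
    and rlin_ract: "\<lbrakk>x \<in> carrier M; r \<in> carrier C\<rbrakk> \<Longrightarrow> h (x \<lhd>\<^bsub>M\<^esub> r) = h x \<lhd>\<^bsub>N\<^esub> r"
  using assms by (auto simp: rlin_def)

lemma rhom_iff_rlin: "h \<in> rhom C M N \<longleftrightarrow> rlin C M N h \<and> h \<in> extensional (carrier M)"
  by (auto simp: rhom_def rlin_def PiE_def)

lemma rlin_if_rhom: "h \<in> rhom C M N \<Longrightarrow> rlin C M N h"
  by (simp add: rhom_iff_rlin)

lemma rhom_restrict:
  assumes "right_module C M" and "rlin C M N h"
  shows "restrict h (carrier M) \<in> rhom C M N"
proof -
  interpret right_module C M by fact
  show ?thesis
    using rlinD[OF assms(2)] by (auto simp: rhom_iff_rlin intro!: rlinI ract_closed)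
qed

lemma rlin_zero:
  assumes "right_module C M" and "right_module C N" and "rlin C M N h"
  shows "h \<zero>\<^bsub>M\<^esub> = \<zero>\<^bsub>N\<^esub>"
proof -
  interpret M: right_module C M by fact
  interpret N: right_module C N by fact
  show ?thesis
    using M.zero_ract N.ract_zero rlinD[OF assms(3)]
    by (metis M.C.zero_closed M.M.zero_closed)
qed

lemma rlin_a_inv:
  assumes "right_module C M" and "right_module C N" and "rlin C M N h" and "x \<in> carrier M"
  shows "h (\<ominus>\<^bsub>M\<^esub> x) = \<ominus>\<^bsub>N\<^esub> h x"
proof -
  interpret M: right_module C M by fact
  interpret N: right_module C N by fact
  show ?thesis
    using assms(4) rlinD[OF assms(3)] rlin_zero[OF assms(1-3)]
    by (metis M.M.a_inv_closed M.M.l_neg N.M.minus_equality)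
qed

lemma rlin_minus:
  assumes "right_module C M" and "right_module C N" and "rlin C M N h"
    and "x \<in> carrier M" and "y \<in> carrier M"
  shows "h (x \<ominus>\<^bsub>M\<^esub> y) = h x \<ominus>\<^bsub>N\<^esub> h y"
proof -
  interpret M: right_module C M by fact
  show ?thesis
    using assms by (simp add: a_minus_def rlin_a_inv[OF assms(1-3)] rlin_add[OF assms(3)])
qed

lemma rlin_comp:
  assumes "rlin C L M h" and "rlin C M N h'"
  shows "rlin C L N (\<lambda>x. h' (h x))"
  using rlinD[OF assms(1)] rlinD[OF assms(2)] by (intro rlinI) simp_all

lemma rlin_sum:
  assumes "right_module C N" and "rlin C M N h" and "rlin C M N h'"
  shows "rlin C M N (\<lambda>x. h x \<oplus>\<^bsub>N\<^esub> h' x)"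
proof -
  interpret N: right_module C N by fact
  show ?thesis
    using rlinD[OF assms(2)] rlinD[OF assms(3)]
    by (intro rlinI) (simp_all add: N.M.a_ac N.ract_add_left)
qed

lemma rlin_diff:
  assumes "right_module C N" and "rlin C M N h" and "rlin C M N h'"
  shows "rlin C M N (\<lambda>x. h x \<ominus>\<^bsub>N\<^esub> h' x)"
proof -
  interpret N: right_module C N by fact
  show ?thesis
    using rlinD[OF assms(2)] rlinD[OF assms(3)]
    by (intro rlinI) (simp_all add: N.ract_minus_left a_minus_def N.M.minus_add N.M.a_ac
         N.ract_add_left N.ract_a_inv_left)
qed

lemma rlin_eq_iff_minus_in_kernel:
  assumes "right_module C M" and "right_module C N" and "rlin C M N h"
    and "x \<in> carrier M" and "y \<in> carrier M"
  shows "h x = h y \<longleftrightarrow> h (x \<ominus>\<^bsub>M\<^esub> y) = \<zero>\<^bsub>N\<^esub>"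
proof -
  interpret N: right_module C N by fact
  show ?thesis
    using rlinD(1)[OF assms(3)] assms(4,5) by (simp add: rlin_minus[OF assms] N.M.minus_eq_zero_iff)
qed

lemma finite_in_fg_modules:
  assumes "right_module C M" and "finite (carrier M)"
  shows "M \<in> fg_modules C"
  using assms by (auto simp: fg_modules_def finitely_generated_def rsubmodule_def intro!: exI[of _ "carrier M"])

subsection \<open>Quotients of finite modules\<close>

text \<open>The hypotheses make the fibres of \<open>\<rho>\<close> a congruence, so the operations
  descend to the image. Since \<open>\<rho>\<close> is an arbitrary function, the carrier type of
  the quotient is free to choose.\<close>

lemma induced_right_module:
  fixes \<rho> :: "'t \<Rightarrow> 'u"
  assumes M: "right_module C M"
    and add_cong: "\<And>x x' y y'. \<lbrakk>x \<in> carrier M; x' \<in> carrier M; y \<in> carrier M; y' \<in> carrier M;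
        \<rho> x = \<rho> x'; \<rho> y = \<rho> y'\<rbrakk> \<Longrightarrow> \<rho> (x \<oplus>\<^bsub>M\<^esub> y) = \<rho> (x' \<oplus>\<^bsub>M\<^esub> y')"
    and ract_cong: "\<And>x x' r. \<lbrakk>x \<in> carrier M; x' \<in> carrier M; r \<in> carrier C; \<rho> x = \<rho> x'\<rbrakk>
        \<Longrightarrow> \<rho> (x \<lhd>\<^bsub>M\<^esub> r) = \<rho> (x' \<lhd>\<^bsub>M\<^esub> r)"
  obtains N where "right_module C N" and "carrier N = \<rho> ` carrier M" and "rlin C M N \<rho>"
proof -
  interpret right_module C M by fact
  define \<sigma> where "\<sigma> = inv_into (carrier M) \<rho>"
  define N :: "('a, 'u) rmodule" where
    "N = \<lparr>carrier = \<rho> ` carrier M, monoid.mult = undefined, monoid.one = undefined,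
      ring.zero = \<rho> \<zero>\<^bsub>M\<^esub>, ring.add = (\<lambda>x y. \<rho> (\<sigma> x \<oplus>\<^bsub>M\<^esub> \<sigma> y)),
      ract = (\<lambda>x r. \<rho> (\<sigma> x \<lhd>\<^bsub>M\<^esub> r))\<rparr>"
  have \<sigma>: "\<sigma> (\<rho> x) \<in> carrier M" "\<rho> (\<sigma> (\<rho> x)) = \<rho> x" if "x \<in> carrier M" for x
    using that by (auto simp: \<sigma>_def inv_into_into f_inv_into_f)
  have N: "carrier N = \<rho> ` carrier M" "\<zero>\<^bsub>N\<^esub> = \<rho> \<zero>\<^bsub>M\<^esub>" by (simp_all add: N_def)
  have add: "\<rho> x \<oplus>\<^bsub>N\<^esub> \<rho> y = \<rho> (x \<oplus>\<^bsub>M\<^esub> y)" if "x \<in> carrier M" "y \<in> carrier M" for x y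
    unfolding N_def using that \<sigma> by (auto intro: add_cong)
  have act: "\<rho> x \<lhd>\<^bsub>N\<^esub> r = \<rho> (x \<lhd>\<^bsub>M\<^esub> r)" if "x \<in> carrier M" "r \<in> carrier C" for x r
    unfolding N_def using that \<sigma> by (auto intro: ract_cong)
  have "abelian_group N"
  proof (rule abelian_groupI)
    fix x assume "x \<in> carrier N"
    then obtain x' where x': "x' \<in> carrier M" "x = \<rho> x'" by (auto simp: N)
    then show "\<exists>y\<in>carrier N. y \<oplus>\<^bsub>N\<^esub> x = \<zero>\<^bsub>N\<^esub>"
      by (intro bexI[of _ "\<rho> (\<ominus>\<^bsub>M\<^esub> x')"]) (auto simp: N add M.l_neg)
  qed (auto simp: N add M.a_ac)
  then have "right_module C N"
    by (intro right_module.intro right_module_axioms.intro C.ring_axioms)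
       (auto simp: N add act ract_closed ract_add_left ract_add_right ract_mult ract_one)
  moreover have "rlin C M N \<rho>"
    by (intro rlinI) (auto simp: N add act)
  ultimately show thesis
    using that N by blast
qed

lemma ex_inj_on_finite_into_infinite:
  assumes "finite A" and "infinite (UNIV :: 'u set)"
  obtains j :: "'t \<Rightarrow> 'u" where "inj_on j A"
proof -
  obtain B :: "'u set" where "finite B" "card B = card A"
    using infinite_arbitrarily_large[OF assms(2)] by blast
  then obtain j where "bij_betw j A B"
    using finite_same_card_bij[OF assms(1)] by metis
  then show thesis
    using that bij_betw_imp_inj_on by blast
qed

text \<open>The cosets are sets over \<open>'t\<close>; as there are finitely many of them, they can
  be renamed injectively by elements of the infinite type \<open>'u\<close>.\<close>

lemma quotient_rmodule:
  fixes M :: "('c, 't) rmodule" and C :: "('c, 'r) ring_scheme"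
  assumes M: "right_module C M" and fin: "finite (carrier M)" and I: "rsubmodule C I M"
    and inf: "infinite (UNIV :: 'u set)"
  obtains N :: "('c, 'u) rmodule" and \<rho> where "right_module C N" and "N \<in> fg_modules C"
    and "rlin C M N \<rho>" and "\<rho> ` carrier M = carrier N"
    and "\<And>x. x \<in> carrier M \<Longrightarrow> \<rho> x = \<zero>\<^bsub>N\<^esub> \<longleftrightarrow> x \<in> I"
proof -
  interpret right_module C M by fact
  have I: "I \<subseteq> carrier M" "\<zero>\<^bsub>M\<^esub> \<in> I" "\<And>x y. \<lbrakk>x \<in> I; y \<in> I\<rbrakk> \<Longrightarrow> x \<oplus>\<^bsub>M\<^esub> y \<in> I"
    "\<And>x r. \<lbrakk>x \<in> I; r \<in> carrier C\<rbrakk> \<Longrightarrow> x \<lhd>\<^bsub>M\<^esub> r \<in> I"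
    using I by (auto simp: rsubmodule_def)
  \<comment> \<open>\<open>rsubmodule\<close> does not mention negatives; they arise from the action
    of \<open>\<ominus> \<one>\<close>.\<close>
  have I_inv: "\<ominus>\<^bsub>M\<^esub> x \<in> I" if "x \<in> I" for x
    using I(4)[OF that, of "\<ominus>\<^bsub>C\<^esub> \<one>\<^bsub>C\<^esub>"] that I(1) by (auto simp: ract_a_inv_right ract_one subset_iff)
  define q where "q x = {y \<in> carrier M. y \<ominus>\<^bsub>M\<^esub> x \<in> I}" for x
  obtain j :: "'t set \<Rightarrow> 'u" where j: "inj_on j (q ` carrier M)"
    using ex_inj_on_finite_into_infinite[of "q ` carrier M"] fin inf by blast
  define \<rho> where "\<rho> x = j (q x)" for x
  have trans: "x \<ominus>\<^bsub>M\<^esub> z \<in> I" if "x \<ominus>\<^bsub>M\<^esub> y \<in> I" "y \<ominus>\<^bsub>M\<^esub> z \<in> I" "x \<in> carrier M" "y \<in> carrier M" "z \<in> carrier M" for x y z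
  proof -
    have "x \<ominus>\<^bsub>M\<^esub> z = (x \<ominus>\<^bsub>M\<^esub> y) \<oplus>\<^bsub>M\<^esub> (y \<ominus>\<^bsub>M\<^esub> z)"
      using that(3-5) by (simp add: a_minus_def M.a_assoc M.r_neg2 M.r_neg1)
    then show ?thesis using I(3) that by simp
  qed
  have sym: "y \<ominus>\<^bsub>M\<^esub> x \<in> I" if "x \<ominus>\<^bsub>M\<^esub> y \<in> I" "x \<in> carrier M" "y \<in> carrier M" for x y
    using I_inv[OF that(1)] that(2,3) by (simp add: a_minus_def M.minus_add M.a_comm)
  have refl: "x \<ominus>\<^bsub>M\<^esub> x \<in> I" if "x \<in> carrier M" for x
    using that I(2) M.minus_eq_zero_iff[of x x] by simp
  have q_eq: "q x = q y \<longleftrightarrow> x \<ominus>\<^bsub>M\<^esub> y \<in> I" if "x \<in> carrier M" "y \<in> carrier M" for x y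
    unfolding q_def using that trans sym refl by blast
  have \<rho>: "\<rho> x = \<rho> y \<longleftrightarrow> x \<ominus>\<^bsub>M\<^esub> y \<in> I" if "x \<in> carrier M" "y \<in> carrier M" for x y
    unfolding \<rho>_def using q_eq[OF that] inj_on_eq_iff[OF j] that by blast
  obtain N where N: "right_module C N" "carrier N = \<rho> ` carrier M" "rlin C M N \<rho>"
  proof (rule induced_right_module[OF M, of \<rho>])
    fix x x' y y'
    assume *: "x \<in> carrier M" "x' \<in> carrier M" "y \<in> carrier M" "y' \<in> carrier M"
      "\<rho> x = \<rho> x'" "\<rho> y = \<rho> y'"
    have "(x \<oplus>\<^bsub>M\<^esub> y) \<ominus>\<^bsub>M\<^esub> (x' \<oplus>\<^bsub>M\<^esub> y') = (x \<ominus>\<^bsub>M\<^esub> x') \<oplus>\<^bsub>M\<^esub> (y \<ominus>\<^bsub>M\<^esub> y')"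
      using * by (simp add: a_minus_def M.minus_add M.a_ac)
    then show "\<rho> (x \<oplus>\<^bsub>M\<^esub> y) = \<rho> (x' \<oplus>\<^bsub>M\<^esub> y')"
      using * \<rho> I(3) by simp
  next
    fix x x' r
    assume *: "x \<in> carrier M" "x' \<in> carrier M" "r \<in> carrier C" "\<rho> x = \<rho> x'"
    then show "\<rho> (x \<lhd>\<^bsub>M\<^esub> r) = \<rho> (x' \<lhd>\<^bsub>M\<^esub> r)"
      using \<rho> I(4) by (simp add: ract_closed ract_minus_left[symmetric])
  qed blast
  show thesis
  proof
    show "N \<in> fg_modules C"
      using finite_in_fg_modules[OF N(1)] N(2) fin by simp
    fix x assume x: "x \<in> carrier M"
    have minus_zero: "x \<ominus>\<^bsub>M\<^esub> \<zero>\<^bsub>M\<^esub> = x"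
      using x by (metis M.minus_eq M.r_zero M.minus_equality M.zero_closed)
    have "\<rho> x = \<zero>\<^bsub>N\<^esub> \<longleftrightarrow> \<rho> x = \<rho> \<zero>\<^bsub>M\<^esub>"
      using rlin_zero[OF M N(1) N(3)] by simp
    also have "\<dots> \<longleftrightarrow> x \<in> I"
      using x \<rho>[of x "\<zero>\<^bsub>M\<^esub>"] minus_zero by simp
    finally show "\<rho> x = \<zero>\<^bsub>N\<^esub> \<longleftrightarrow> x \<in> I" .
  qed (use N in auto)
qed

subsection \<open>Free and projective modules\<close>

definition regular_module :: "('c, 'r) ring_scheme \<Rightarrow> ('c, 'c) rmodule" where
  "regular_module C =
     \<lparr>carrier = carrier C, monoid.mult = (\<otimes>\<^bsub>C\<^esub>), monoid.one = \<one>\<^bsub>C\<^esub>,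
      ring.zero = \<zero>\<^bsub>C\<^esub>, ring.add = (\<oplus>\<^bsub>C\<^esub>), ract = (\<otimes>\<^bsub>C\<^esub>)\<rparr>"

lemma regular_module_simps [simp]:
  "carrier (regular_module C) = carrier C"
  "\<zero>\<^bsub>regular_module C\<^esub> = \<zero>\<^bsub>C\<^esub>"
  "x \<oplus>\<^bsub>regular_module C\<^esub> y = x \<oplus>\<^bsub>C\<^esub> y"
  "x \<lhd>\<^bsub>regular_module C\<^esub> r = x \<otimes>\<^bsub>C\<^esub> r"
  by (simp_all add: regular_module_def)

lemma (in ring) regular_module_minus [simp]:
  "x \<ominus>\<^bsub>regular_module R\<^esub> y = x \<ominus>\<^bsub>R\<^esub> y"
  by (simp add: a_minus_def a_inv_def m_inv_def regular_module_def)

lemma (in ring) right_module_regular: "right_module R (regular_module R)"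
proof (intro right_module.intro right_module_axioms.intro ring_axioms abelian_groupI)
  fix x assume "x \<in> carrier (regular_module R)"
  then show "\<exists>y\<in>carrier (regular_module R). y \<oplus>\<^bsub>regular_module R\<^esub> x = \<zero>\<^bsub>regular_module R\<^esub>"
    by (auto intro!: bexI[of _ "\<ominus> x"] simp: l_neg)
qed (auto simp: a_ac l_distr r_distr m_assoc)

definition free_module :: "('c, 'r) ring_scheme \<Rightarrow> 's set \<Rightarrow> ('c, 's \<Rightarrow> 'c) rmodule" where
  "free_module C S =
     \<lparr>carrier = S \<rightarrow>\<^sub>E carrier C, monoid.mult = undefined, monoid.one = undefined,
      ring.zero = (\<lambda>s\<in>S. \<zero>\<^bsub>C\<^esub>), ring.add = (\<lambda>x y. \<lambda>s\<in>S. x s \<oplus>\<^bsub>C\<^esub> y s),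
      ract = (\<lambda>x r. \<lambda>s\<in>S. x s \<otimes>\<^bsub>C\<^esub> r)\<rparr>"

lemma free_module_simps:
  "carrier (free_module C S) = S \<rightarrow>\<^sub>E carrier C"
  "\<zero>\<^bsub>free_module C S\<^esub> = (\<lambda>s\<in>S. \<zero>\<^bsub>C\<^esub>)"
  "x \<oplus>\<^bsub>free_module C S\<^esub> y = (\<lambda>s\<in>S. x s \<oplus>\<^bsub>C\<^esub> y s)"
  "x \<lhd>\<^bsub>free_module C S\<^esub> r = (\<lambda>s\<in>S. x s \<otimes>\<^bsub>C\<^esub> r)"
  by (simp_all add: free_module_def)

lemma (in ring) right_module_free: "right_module R (free_module R S)"
proof (intro right_module.intro right_module_axioms.intro ring_axioms abelian_groupI)
  fix x assume "x \<in> carrier (free_module R S)"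
  then show "\<exists>y\<in>carrier (free_module R S). y \<oplus>\<^bsub>free_module R S\<^esub> x = \<zero>\<^bsub>free_module R S\<^esub>"
    by (intro bexI[of _ "\<lambda>s\<in>S. \<ominus> x s"]) (auto simp: free_module_simps l_neg PiE_iff intro!: restrict_ext)
qed (auto simp: free_module_simps a_ac l_distr r_distr m_assoc PiE_iff extensional_def intro!: restrict_ext)

lemma projective_lift_same:
  fixes P M N :: "('c, 'u) rmodule"
  assumes P: "projective C P" and M: "right_module C M" and N: "right_module C N"
    and g: "rlin C M N g" "g ` carrier M = carrier N" and h: "rlin C P N h"
  obtains k where "rlin C P M k" and "\<And>x. x \<in> carrier P \<Longrightarrow> g (k x) = h x"
proof -
  have P': "right_module C P" using P by (simp add: projective_def)
  have surj: "restrict g (carrier M) ` carrier M = carrier N"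
    using g(2) by simp
  obtain k where k: "k \<in> rhom C P M" "compose (carrier P) (restrict g (carrier M)) k = restrict h (carrier P)"
    using P M N surj rhom_restrict[OF M g(1)] rhom_restrict[OF P' h] unfolding projective_def by blast
  show thesis
  proof
    show "rlin C P M k" using rlin_if_rhom[OF k(1)] .
    fix x assume x: "x \<in> carrier P"
    have "compose (carrier P) (restrict g (carrier M)) k x = h x"
      using k(2) x by simp
    then show "g (k x) = h x"
      using x rlin_closed[OF rlin_if_rhom[OF k(1)] x] by (simp add: compose_def)
  qed
qed

text \<open>The definition of \<open>projective\<close> tests surjections between modules with
  carrier in \<open>'u\<close> only. A finite module over another type has a copy in
  \<open>'u\<close>, namely its quotient by zero, and lifts are transported through this
  copy.\<close>

lemma projective_lift:
  fixes M :: "('c, 't) rmodule" and P N :: "('c, 'u) rmodule" and C :: "('c, 'r) ring_scheme"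
  assumes P: "projective C P" and M: "right_module C M" "finite (carrier M)"
    and N: "right_module C N" and inf: "infinite (UNIV :: 'u set)"
    and g: "rlin C M N g" "g ` carrier M = carrier N" and h: "rlin C P N h"
  obtains k where "rlin C P M k" and "\<And>x. x \<in> carrier P \<Longrightarrow> g (k x) = h x"
proof -
  interpret M: right_module C M by fact
  have zero: "rsubmodule C {\<zero>\<^bsub>M\<^esub>} M"
    by (simp add: rsubmodule_def M.zero_ract)
  obtain M' :: "('c, 'u) rmodule" and \<rho> where M': "right_module C M'" "rlin C M M' \<rho>"
    "\<rho> ` carrier M = carrier M'" and \<rho>_ker: "\<And>x. x \<in> carrier M \<Longrightarrow> \<rho> x = \<zero>\<^bsub>M'\<^esub> \<longleftrightarrow> x \<in> {\<zero>\<^bsub>M\<^esub>}"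
    using quotient_rmodule[OF M zero inf] by metis
  have inj: "inj_on \<rho> (carrier M)"
    by (rule inj_onI)
       (metis rlin_eq_iff_minus_in_kernel[OF M(1) M'(1,2)] \<rho>_ker singletonD M.M.minus_closed M.M.minus_eq_zero_iff)
  define \<sigma> where "\<sigma> = inv_into (carrier M) \<rho>"
  have \<sigma>: "\<sigma> (\<rho> x) = x" if "x \<in> carrier M" for x
    using that inj by (simp add: \<sigma>_def)
  have \<sigma>_lin: "rlin C M' M \<sigma>"
    by (rule rlinI) (auto simp: M'(3)[symmetric] \<sigma> M.ract_closed
        rlin_add[OF M'(2), symmetric] rlin_ract[OF M'(2), symmetric])
  have "rlin C M' N (\<lambda>x. g (\<sigma> x))"
    by (rule rlin_comp[OF \<sigma>_lin g(1)])
  moreover have "(\<lambda>x. g (\<sigma> x)) ` carrier M' = carrier N"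
    by (simp add: M'(3)[symmetric] image_image \<sigma> g(2) cong: image_cong)
  ultimately obtain k where "rlin C P M' k" "\<And>x. x \<in> carrier P \<Longrightarrow> g (\<sigma> (k x)) = h x"
    using projective_lift_same[OF P M'(1) N _ _ h] by blast
  then show thesis
    using that[of "\<lambda>x. \<sigma> (k x)"] rlin_comp[OF _ \<sigma>_lin] by blast
qed

lemma (in right_module) finsum_ract:
  assumes "finite S" and "g \<in> S \<rightarrow> carrier M" and "r \<in> carrier C"
  shows "finsum M g S \<lhd>\<^bsub>M\<^esub> r = finsum M (\<lambda>s. g s \<lhd>\<^bsub>M\<^esub> r) S"
  using assms(1,2)
proof (induction S rule: finite_induct)
  case empty
  then show ?case using assms(3) by (simp add: zero_ract)
next
  case (insert s S)
  then have "g s \<in> carrier M" "g \<in> S \<rightarrow> carrier M" "(\<lambda>s. g s \<lhd>\<^bsub>M\<^esub> r) \<in> S \<rightarrow> carrier M"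
    using assms(3) by (auto intro: ract_closed)
  then show ?case
    using insert assms(3) by (simp add: M.finsum_insert ract_closed ract_add_left)
qed

text \<open>Over a finite ring the free module on finitely many generators is finite, so the
  identity of \<open>P\<close> lifts along the surjection that the generators define. As a retract
  of a free module, \<open>P\<close> inherits annihilator properties that can be checked
  coordinatewise in the ring.\<close>

lemma projective_retract_of_free:
  fixes P :: "('c, 'u) rmodule" and C :: "('c, 'r) ring_scheme"
  assumes P: "projective C P" "P \<in> fg_modules C" and fin: "finite (carrier C)"
    and inf: "infinite (UNIV :: 'u set)"
  obtains S :: "'u set" and \<iota> \<pi> where "rlin C P (free_module C S) \<iota>"
    and "rlin C (free_module C S) P \<pi>" and "\<And>x. x \<in> carrier P \<Longrightarrow> \<pi> (\<iota> x) = x"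
proof -
  have P': "right_module C P" using P(1) by (simp add: projective_def)
  interpret right_module C P by fact
  obtain S where S: "finite S" "S \<subseteq> carrier P"
    and gen: "\<And>U. \<lbrakk>rsubmodule C U P; S \<subseteq> U\<rbrakk> \<Longrightarrow> U = carrier P"
    using P(2) by (auto simp: fg_modules_def finitely_generated_def)
  define F where "F = free_module C S"
  define \<pi> where "\<pi> g = (\<Oplus>\<^bsub>P\<^esub>s\<in>S. s \<lhd>\<^bsub>P\<^esub> g s)" for g
  have F: "right_module C F" unfolding F_def by (rule right_module_free)
  interpret F: right_module C F by fact
  have carrier_F: "g s \<in> carrier C" if "g \<in> carrier F" "s \<in> S" for g s
    using that by (auto simp: F_def free_module_simps)
  have act: "(\<lambda>s. s \<lhd>\<^bsub>P\<^esub> g s) \<in> S \<rightarrow> carrier P" if "g \<in> carrier F" for g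
    using S(2) carrier_F[OF that] by (auto intro: ract_closed)
  have \<pi>_lin: "rlin C F P \<pi>"
  proof (rule rlinI)
    fix g assume "g \<in> carrier F"
    then show "\<pi> g \<in> carrier P"
      using act by (simp add: \<pi>_def)
  next
    fix g h assume gh: "g \<in> carrier F" "h \<in> carrier F"
    have "\<pi> (g \<oplus>\<^bsub>F\<^esub> h) = (\<Oplus>\<^bsub>P\<^esub>s\<in>S. s \<lhd>\<^bsub>P\<^esub> g s \<oplus>\<^bsub>P\<^esub> s \<lhd>\<^bsub>P\<^esub> h s)"
      unfolding \<pi>_def using S(2) carrier_F gh
      by (intro M.finsum_cong' refl) (auto simp: F_def free_module_simps ract_add_right intro!: ract_closed M.a_closed)
    then show "\<pi> (g \<oplus>\<^bsub>F\<^esub> h) = \<pi> g \<oplus>\<^bsub>P\<^esub> \<pi> h"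
      using act gh by (simp add: \<pi>_def M.finsum_addf)
  next
    fix g r assume gr: "g \<in> carrier F" "r \<in> carrier C"
    have "\<pi> (g \<lhd>\<^bsub>F\<^esub> r) = (\<Oplus>\<^bsub>P\<^esub>s\<in>S. s \<lhd>\<^bsub>P\<^esub> g s \<lhd>\<^bsub>P\<^esub> r)"
      unfolding \<pi>_def using S(2) carrier_F gr
      by (intro M.finsum_cong' refl) (auto simp: F_def free_module_simps ract_mult intro!: ract_closed)
    then show "\<pi> (g \<lhd>\<^bsub>F\<^esub> r) = \<pi> g \<lhd>\<^bsub>P\<^esub> r"
      using finsum_ract[OF S(1) act[OF gr(1)] gr(2)] by (simp add: \<pi>_def)
  qed
  have "rsubmodule C (\<pi> ` carrier F) P"
    unfolding rsubmodule_def
  proof (intro conjI ballI)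
    show "\<pi> ` carrier F \<subseteq> carrier P"
      using rlin_closed[OF \<pi>_lin] by blast
    show "\<zero>\<^bsub>P\<^esub> \<in> \<pi> ` carrier F"
      using rlin_zero[OF F P' \<pi>_lin] by (metis F.M.zero_closed imageI)
    fix m n assume "m \<in> \<pi> ` carrier F" "n \<in> \<pi> ` carrier F"
    then show "m \<oplus>\<^bsub>P\<^esub> n \<in> \<pi> ` carrier F"
      by (auto simp: rlin_add[OF \<pi>_lin, symmetric])
  next
    fix m r assume "m \<in> \<pi> ` carrier F" "r \<in> carrier C"
    then show "m \<lhd>\<^bsub>P\<^esub> r \<in> \<pi> ` carrier F"
      by (auto simp: rlin_ract[OF \<pi>_lin, symmetric] F.ract_closed)
  qed
  moreover have "S \<subseteq> \<pi> ` carrier F"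
  proof
    fix t assume t: "t \<in> S"
    define \<delta> where "\<delta> = (\<lambda>s\<in>S. if t = s then \<one>\<^bsub>C\<^esub> else \<zero>\<^bsub>C\<^esub>)"
    have "\<pi> \<delta> = (\<Oplus>\<^bsub>P\<^esub>s\<in>S. if t = s then s else \<zero>\<^bsub>P\<^esub>)"
      unfolding \<pi>_def using S(2) by (intro M.finsum_cong' refl) (auto simp: \<delta>_def ract_one ract_zero)
    also have "\<dots> = t"
      using M.finsum_singleton[OF t S(1), of "\<lambda>s. s"] S(2) by auto
    finally show "t \<in> \<pi> ` carrier F"
      by (intro image_eqI[of _ _ \<delta>]) (auto simp: \<delta>_def F_def free_module_simps)
  qed
  ultimately have surj: "\<pi> ` carrier F = carrier P"
    using gen by blast
  have "rlin C P P (\<lambda>x. x)"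
    by (intro rlinI) auto
  moreover have "finite (carrier F)"
    using S(1) fin by (simp add: F_def free_module_simps finite_PiE)
  ultimately obtain \<iota> where "rlin C P F \<iota>" "\<And>x. x \<in> carrier P \<Longrightarrow> \<pi> (\<iota> x) = x"
    using projective_lift[OF P(1) F _ P' inf \<pi>_lin surj] by metis
  then show thesis
    using that \<pi>_lin unfolding F_def by blast
qed

subsection \<open>Cyclic modules\<close>

text \<open>An isomorphism of \<open>C / I\<close> with \<open>X\<close>, kept as the surjection
  \<open>\<rho>\<close> so that \<open>X\<close> may live in \<open>'u\<close>. The generator is
  \<open>\<rho> \<one>\<close>.\<close>

definition presents ::
  "('c, 'r) ring_scheme \<Rightarrow> 'c set \<Rightarrow> ('c, 'u) rmodule \<Rightarrow> ('c \<Rightarrow> 'u) \<Rightarrow> bool" where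
  "presents C I X \<rho> \<longleftrightarrow> right_module C X \<and> rlin C (regular_module C) X \<rho> \<and>
     \<rho> ` carrier C = carrier X \<and> (\<forall>r\<in>carrier C. \<rho> r = \<zero>\<^bsub>X\<^esub> \<longleftrightarrow> r \<in> I)"

lemma presentsD:
  assumes "presents C I X \<rho>"
  shows presents_module: "right_module C X"
    and presents_rlin: "rlin C (regular_module C) X \<rho>"
    and presents_surj: "\<rho> ` carrier C = carrier X"
    and presents_kernel: "r \<in> carrier C \<Longrightarrow> \<rho> r = \<zero>\<^bsub>X\<^esub> \<longleftrightarrow> r \<in> I"
  using assms by (auto simp: presents_def)

lemma presents_fg:
  assumes "presents C I X \<rho>" and "finite (carrier C)"
  shows "X \<in> fg_modules C"
  using finite_in_fg_modules[OF presents_module[OF assms(1)]] presents_surj[OF assms(1)] assms(2)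
  by (metis finite_imageI)

lemma presents_one:
  assumes "presents C I X \<rho>" and "r \<in> carrier C"
  shows "\<rho> \<one>\<^bsub>C\<^esub> \<lhd>\<^bsub>X\<^esub> r = \<rho> r"
proof -
  interpret right_module C X using presents_module[OF assms(1)] .
  show ?thesis
    using rlin_ract[OF presents_rlin[OF assms(1)], of "\<one>\<^bsub>C\<^esub>" r] assms(2) by simp
qed

lemma ex_presents:
  fixes C :: "('c, 'r) ring_scheme"
  assumes "ring C" and "finite (carrier C)" and "infinite (UNIV :: 'u set)"
    and "rsubmodule C I (regular_module C)"
  obtains X :: "('c, 'u) rmodule" and \<rho> where "presents C I X \<rho>"
proof -
  interpret ring C by fact
  obtain X :: "('c, 'u) rmodule" and \<rho> where "right_module C X" "rlin C (regular_module C) X \<rho>"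
    "\<rho> ` carrier (regular_module C) = carrier X"
    "\<And>x. x \<in> carrier (regular_module C) \<Longrightarrow> \<rho> x = \<zero>\<^bsub>X\<^esub> \<longleftrightarrow> x \<in> I"
    using quotient_rmodule[OF right_module_regular _ assms(4,3)] assms(2) by (metis regular_module_simps(1))
  then have "presents C I X \<rho>"
    by (simp add: presents_def)
  then show thesis
    by (rule that)
qed

lemma presents_eqD:
  assumes "presents C I X \<rho>" and "right_module C Y" and "y \<in> carrier Y"
    and I: "\<And>r. \<lbrakk>r \<in> carrier C; r \<in> I\<rbrakk> \<Longrightarrow> y \<lhd>\<^bsub>Y\<^esub> r = \<zero>\<^bsub>Y\<^esub>"
    and "r \<in> carrier C" and "s \<in> carrier C" and "\<rho> r = \<rho> s"
  shows "y \<lhd>\<^bsub>Y\<^esub> r = y \<lhd>\<^bsub>Y\<^esub> s"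
proof -
  interpret Y: right_module C Y by fact
  have "\<rho> (r \<ominus>\<^bsub>C\<^esub> s) = \<zero>\<^bsub>X\<^esub>"
    using rlin_eq_iff_minus_in_kernel[OF Y.right_module_regular presents_module[OF assms(1)]
        presents_rlin[OF assms(1)], of r s] assms(5-7) by simp
  then have "y \<lhd>\<^bsub>Y\<^esub> (r \<ominus>\<^bsub>C\<^esub> s) = \<zero>\<^bsub>Y\<^esub>"
    using I presents_kernel[OF assms(1)] assms(5,6) by simp
  then show ?thesis
    using assms(3,5,6) by (simp add: Y.ract_minus_right Y.M.minus_eq_zero_iff Y.ract_closed)
qed

text \<open>Universal property of \<open>C / I\<close>: two preimages of an element differ by a
  member of \<open>I\<close>, which annihilates \<open>y\<close>, so the value computed from a
  chosen preimage does not depend on the choice.\<close>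

lemma presents_induced:
  assumes X: "presents C I X \<rho>" and Y: "right_module C Y" and y: "y \<in> carrier Y"
    and I: "\<And>r. \<lbrakk>r \<in> carrier C; r \<in> I\<rbrakk> \<Longrightarrow> y \<lhd>\<^bsub>Y\<^esub> r = \<zero>\<^bsub>Y\<^esub>"
  obtains g where "g \<in> rhom C X Y" and "\<And>r. r \<in> carrier C \<Longrightarrow> g (\<rho> r) = y \<lhd>\<^bsub>Y\<^esub> r"
proof -
  interpret Y: right_module C Y by fact
  interpret X: right_module C X using presents_module[OF X] .
  note \<rho> = presents_rlin[OF X]
  define g where "g x = y \<lhd>\<^bsub>Y\<^esub> inv_into (carrier C) \<rho> x" for x
  have g: "g (\<rho> r) = y \<lhd>\<^bsub>Y\<^esub> r" if "r \<in> carrier C" for r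
    unfolding g_def using that
    by (intro presents_eqD[OF X Y y I]) (auto intro: inv_into_into f_inv_into_f)
  have \<rho>_add: "\<rho> r \<oplus>\<^bsub>X\<^esub> \<rho> s = \<rho> (r \<oplus>\<^bsub>C\<^esub> s)" and \<rho>_ract: "\<rho> r \<lhd>\<^bsub>X\<^esub> s = \<rho> (r \<otimes>\<^bsub>C\<^esub> s)"
    if "r \<in> carrier C" "s \<in> carrier C" for r s
    using rlin_add[OF \<rho>, of r s] rlin_ract[OF \<rho>, of r s] that by simp_all
  have "rlin C X Y g"
    by (rule rlinI)
       (auto simp: presents_surj[OF X, symmetric] \<rho>_add \<rho>_ract g Y.ract_closed
         Y.ract_add_right Y.ract_mult y)
  then have "restrict g (carrier X) \<in> rhom C X Y"
    by (rule rhom_restrict[OF X.right_module_axioms])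
  moreover have "restrict g (carrier X) (\<rho> r) = y \<lhd>\<^bsub>Y\<^esub> r" if "r \<in> carrier C" for r
    using that g presents_surj[OF X] by (auto simp: restrict_def)
  ultimately show thesis
    using that by blast
qed

lemma presents_hom:
  assumes "presents C I X \<rho>" and "rlin C X Y h" and "r \<in> carrier C"
  shows "h (\<rho> r) = h (\<rho> \<one>\<^bsub>C\<^esub>) \<lhd>\<^bsub>Y\<^esub> r"
proof -
  interpret right_module C X using presents_module[OF assms(1)] .
  have "\<rho> \<one>\<^bsub>C\<^esub> \<in> carrier X"
    using presents_surj[OF assms(1)] by (metis C.one_closed imageI)
  then show ?thesis
    using rlin_ract[OF assms(2), of "\<rho> \<one>\<^bsub>C\<^esub>" r] presents_one[OF assms(1,3)] assms(3) by simp
qed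

text \<open>With zero kernel \<open>P\<close> is a copy of the regular module, and a lift is
  obtained by lifting the image of the generator.\<close>

lemma presents_zero_projective:
  assumes P: "presents C {\<zero>\<^bsub>C\<^esub>} P \<rho>"
  shows "projective C P"
  unfolding projective_def
proof (intro conjI allI impI presents_module[OF P])
  fix M N g h
  assume "right_module C M \<and> right_module C N \<and> g \<in> rhom C M N \<and> g ` carrier M = carrier N \<and> h \<in> rhom C P N"
  then have M: "right_module C M" and N: "right_module C N" and g: "g \<in> rhom C M N"
    and surj: "g ` carrier M = carrier N" and h: "h \<in> rhom C P N" by auto
  interpret M: right_module C M by fact
  interpret P: right_module C P using presents_module[OF P] .
  have gen: "\<rho> \<one>\<^bsub>C\<^esub> \<in> carrier P"
    using presents_surj[OF P] by (metis M.C.one_closed imageI)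
  then have "h (\<rho> \<one>\<^bsub>C\<^esub>) \<in> g ` carrier M"
    using rlin_closed[OF rlin_if_rhom[OF h]] surj by simp
  then obtain m where m: "m \<in> carrier M" "g m = h (\<rho> \<one>\<^bsub>C\<^esub>)" by force
  obtain k where k: "k \<in> rhom C P M" "\<And>r. r \<in> carrier C \<Longrightarrow> k (\<rho> r) = m \<lhd>\<^bsub>M\<^esub> r"
    using presents_induced[OF P M m(1)] M.ract_zero[OF m(1)] by (metis singletonD)
  have "g (k x) = h x" if x: "x \<in> carrier P" for x
  proof -
    obtain r where r: "r \<in> carrier C" "x = \<rho> r"
      using x presents_surj[OF P] by blast
    have "g (k x) = g m \<lhd>\<^bsub>N\<^esub> r"
      unfolding r(2) k(2)[OF r(1)] by (rule rlin_ract[OF rlin_if_rhom[OF g] m(1) r(1)])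
    also have "\<dots> = h x"
      unfolding r(2) m(2) by (rule presents_hom[OF P rlin_if_rhom[OF h] r(1), symmetric])
    finally show ?thesis .
  qed
  moreover have "h \<in> extensional (carrier P)"
    using h by (simp add: rhom_iff_rlin)
  ultimately have "compose (carrier P) g k = h"
    by (intro extensionalityI[of _ "carrier P"]) (simp_all add: compose_def)
  then show "\<exists>k\<in>rhom C P M. compose (carrier P) g k = h"
    using k(1) by blast
qed

subsection \<open>Syzygies of cyclic modules\<close>

text \<open>
  If \<open>X\<close> is presented by \<open>I\<close>, then the map \<open>b : I \<rightarrow> K\<close> and the restriction of \<open>d\<close> to \<open>K\<close> compare
  the given syzygy \<open>K\<close> of \<open>X\<close> with the syzygy \<open>I\<close>, as in Schanuel's lemma.
\<close>

lemma syzygy_comparison: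
  fixes P :: "('c, 'u) rmodule"
  assumes inf: "infinite (UNIV :: 'u set)" and fin: "finite (carrier C)"
    and X: "presents C I X \<rho>" and P: "projective C P" and K: "right_module C K"
    and ex: "short_exact C K P X i p"
  obtains d s b where "rlin C P (regular_module C) d" and "rlin C P K s"
    and "\<And>k. k \<in> carrier K \<Longrightarrow> d (i k) \<in> carrier C \<and> d (i k) \<in> I \<and> k = s (i k) \<oplus>\<^bsub>K\<^esub> b (d (i k))"
    and "\<And>r. \<lbrakk>r \<in> carrier C; r \<in> I\<rbrakk> \<Longrightarrow> b r \<in> carrier K"
    and "\<And>r t. \<lbrakk>r \<in> carrier C; r \<in> I; t \<in> carrier C; t \<in> I\<rbrakk> \<Longrightarrow> b (r \<oplus>\<^bsub>C\<^esub> t) = b r \<oplus>\<^bsub>K\<^esub> b t"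
    and "\<And>r t. \<lbrakk>r \<in> carrier C; r \<in> I; t \<in> carrier C\<rbrakk> \<Longrightarrow> b (r \<otimes>\<^bsub>C\<^esub> t) = b r \<lhd>\<^bsub>K\<^esub> t"
    and "\<And>r. \<lbrakk>r \<in> carrier C; r \<in> I\<rbrakk> \<Longrightarrow> \<exists>c\<in>carrier C. c \<ominus>\<^bsub>C\<^esub> \<one>\<^bsub>C\<^esub> \<in> I \<and> d (i (b r)) = c \<otimes>\<^bsub>C\<^esub> r"
proof -
  interpret K: right_module C K by fact
  have P': "right_module C P" using P by (simp add: projective_def)
  interpret P: right_module C P by fact
  interpret X: right_module C X using presents_module[OF X] .
  have i: "rlin C K P i" and p: "rlin C P X p" and inj: "inj_on i (carrier K)"
    and img: "i ` carrier K = {x \<in> carrier P. p x = \<zero>\<^bsub>X\<^esub>}" and surj: "p ` carrier P = carrier X"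
    using ex by (auto simp: short_exact_def intro: rlin_if_rhom)
  note \<rho> = presents_rlin[OF X]
  have R: "right_module C (regular_module C)"
    by (rule K.right_module_regular)
  \<comment> \<open>The two comparison maps of Schanuel's lemma: \<open>d\<close> lifts
    \<open>p\<close> along \<open>\<rho>\<close>, and \<open>r \<mapsto> y \<lhd> r\<close>, for a
    preimage \<open>y\<close> of the generator, lifts \<open>\<rho>\<close> along
    \<open>p\<close>.\<close>
  obtain d where d: "rlin C P (regular_module C) d" and \<rho>d: "\<And>x. x \<in> carrier P \<Longrightarrow> \<rho> (d x) = p x"
    using projective_lift[OF P R _ presents_module[OF X] inf \<rho> _ p] fin presents_surj[OF X] by auto
  have d_closed: "d x \<in> carrier C" if "x \<in> carrier P" for x
    using rlin_closed[OF d that] by simp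
  have "\<rho> \<one>\<^bsub>C\<^esub> \<in> p ` carrier P"
    using surj presents_surj[OF X] by auto
  then obtain y where y: "y \<in> carrier P" "p y = \<rho> \<one>\<^bsub>C\<^esub>" by force
  define J where "J = inv_into (carrier K) i"
  have J: "J m \<in> carrier K" "i (J m) = m" if "m \<in> carrier P" "p m = \<zero>\<^bsub>X\<^esub>" for m
  proof -
    have "m \<in> i ` carrier K" using img that by simp
    then show "J m \<in> carrier K" "i (J m) = m"
      by (simp_all add: J_def inv_into_into f_inv_into_f)
  qed
  have Ji: "J (i k) = k" if "k \<in> carrier K" for k
    using inj that by (simp add: J_def)
  have J_add: "J (m \<oplus>\<^bsub>P\<^esub> n) = J m \<oplus>\<^bsub>K\<^esub> J n"
    if "m \<in> carrier P" "p m = \<zero>\<^bsub>X\<^esub>" "n \<in> carrier P" "p n = \<zero>\<^bsub>X\<^esub>" for m n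
    using Ji[of "J m \<oplus>\<^bsub>K\<^esub> J n"] J that by (simp add: rlin_add[OF i])
  have J_ract: "J (m \<lhd>\<^bsub>P\<^esub> r) = J m \<lhd>\<^bsub>K\<^esub> r"
    if "m \<in> carrier P" "p m = \<zero>\<^bsub>X\<^esub>" "r \<in> carrier C" for m r
    using Ji[of "J m \<lhd>\<^bsub>K\<^esub> r"] J that by (simp add: rlin_ract[OF i] K.ract_closed)
  have p_y: "p (y \<lhd>\<^bsub>P\<^esub> r) = \<rho> r" if "r \<in> carrier C" for r
    using that y presents_one[OF X that] by (simp add: rlin_ract[OF p])
  \<comment> \<open>The argument of \<open>J\<close> is killed by \<open>p\<close>, hence comes from
    \<open>K\<close>. On \<open>K\<close> this shows that the identity and \<open>b\<close> after
    \<open>d\<close> differ by a map that extends to the projective module \<open>P\<close>.\<close>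
  define s where "s x = J (x \<ominus>\<^bsub>P\<^esub> y \<lhd>\<^bsub>P\<^esub> d x)" for x
  define b where "b r = J (y \<lhd>\<^bsub>P\<^esub> r)" for r
  have y_closed: "y \<lhd>\<^bsub>P\<^esub> r \<in> carrier P" if "r \<in> carrier C" for r
    using that y(1) by (rule P.ract_closed[rotated])
  have s_arg: "rlin C P P (\<lambda>x. x \<ominus>\<^bsub>P\<^esub> y \<lhd>\<^bsub>P\<^esub> d x)"
  proof (rule rlin_diff[OF P'])
    show "rlin C P P (\<lambda>x. x)" by (intro rlinI) auto
    show "rlin C P P (\<lambda>x. y \<lhd>\<^bsub>P\<^esub> d x)"
      using rlin_add[OF d] rlin_ract[OF d] y(1)
      by (intro rlinI) (simp_all add: d_closed P.ract_closed P.ract_add_right P.ract_mult)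
  qed
  have s_arg_ker: "p (x \<ominus>\<^bsub>P\<^esub> y \<lhd>\<^bsub>P\<^esub> d x) = \<zero>\<^bsub>X\<^esub>" if "x \<in> carrier P" for x
    using that rlin_closed[OF p that]
    by (simp add: rlin_minus[OF P' presents_module[OF X] p] y_closed d_closed p_y \<rho>d X.M.minus_eq_zero_iff)
  have b_arg: "y \<lhd>\<^bsub>P\<^esub> r \<in> carrier P" "p (y \<lhd>\<^bsub>P\<^esub> r) = \<zero>\<^bsub>X\<^esub>" if "r \<in> carrier C" "r \<in> I" for r
    using that y_closed p_y presents_kernel[OF X] by simp_all
  show thesis
  proof
    show "rlin C P (regular_module C) d" by fact
    show "rlin C P K s"
      unfolding s_def
      using rlin_closed[OF s_arg] s_arg_ker
      by (intro rlinI) (simp_all add: J rlin_add[OF s_arg] rlin_ract[OF s_arg] J_add J_ract)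
    show "d (i k) \<in> carrier C \<and> d (i k) \<in> I \<and> k = s (i k) \<oplus>\<^bsub>K\<^esub> b (d (i k))" if k: "k \<in> carrier K" for k
    proof (intro conjI)
      have ik: "i k \<in> carrier P" "p (i k) = \<zero>\<^bsub>X\<^esub>"
        using img k by auto
      then show dk: "d (i k) \<in> carrier C" "d (i k) \<in> I"
        using d_closed \<rho>d presents_kernel[OF X, of "d (i k)"] by simp_all
      have "i k = (i k \<ominus>\<^bsub>P\<^esub> y \<lhd>\<^bsub>P\<^esub> d (i k)) \<oplus>\<^bsub>P\<^esub> y \<lhd>\<^bsub>P\<^esub> d (i k)"
        using ik(1) y_closed[OF dk(1)] by (simp add: a_minus_def P.M.a_assoc P.M.l_neg)
      then have "J (i k) = s (i k) \<oplus>\<^bsub>K\<^esub> b (d (i k))"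
        unfolding s_def b_def
        using J_add[OF rlin_closed[OF s_arg ik(1)] s_arg_ker[OF ik(1)] b_arg[OF dk]] by simp
      then show "k = s (i k) \<oplus>\<^bsub>K\<^esub> b (d (i k))"
        using Ji[OF k] by simp
    qed
    show "b r \<in> carrier K" if "r \<in> carrier C" "r \<in> I" for r
      unfolding b_def using J b_arg[OF that] by simp
    show "b (r \<oplus>\<^bsub>C\<^esub> t) = b r \<oplus>\<^bsub>K\<^esub> b t" if "r \<in> carrier C" "r \<in> I" "t \<in> carrier C" "t \<in> I" for r t
      unfolding b_def using that b_arg y(1) by (simp add: P.ract_add_right J_add)
    show "b (r \<otimes>\<^bsub>C\<^esub> t) = b r \<lhd>\<^bsub>K\<^esub> t" if "r \<in> carrier C" "r \<in> I" "t \<in> carrier C" for r t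
      unfolding b_def using that b_arg y(1) by (simp add: P.ract_mult J_ract)
    show "\<exists>c\<in>carrier C. c \<ominus>\<^bsub>C\<^esub> \<one>\<^bsub>C\<^esub> \<in> I \<and> d (i (b r)) = c \<otimes>\<^bsub>C\<^esub> r" if "r \<in> carrier C" "r \<in> I" for r
    proof (intro bexI conjI)
      \<comment> \<open>The witness is \<open>d y\<close>: both \<open>\<rho> (d y)\<close> and
        \<open>\<rho> \<one>\<close> equal \<open>p y\<close>, so it agrees with
        \<open>\<one>\<close> modulo \<open>I\<close>.\<close>
      show "d y \<in> carrier C" using d_closed y(1) .
      then show "d y \<ominus>\<^bsub>C\<^esub> \<one>\<^bsub>C\<^esub> \<in> I"
        using rlin_eq_iff_minus_in_kernel[OF R presents_module[OF X] \<rho>, of "d y" "\<one>\<^bsub>C\<^esub>"]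
          \<rho>d[OF y(1)] y(2) presents_kernel[OF X] by simp
      show "d (i (b r)) = d y \<otimes>\<^bsub>C\<^esub> r"
        unfolding b_def using J b_arg[OF that] rlin_ract[OF d y(1) that(1)] by simp
    qed
  qed
qed

section \<open>Morphisms that factor through a projective module\<close>

text \<open>The morphisms that become zero in the stable category. Only values on the carrier count,
  so the notion also applies to pointwise differences, which are not extensional.\<close>

definition null_hom ::
  "('c, 'r) ring_scheme \<Rightarrow> ('c, 'u) rmodule \<Rightarrow> ('c, 'u) rmodule \<Rightarrow> ('u \<Rightarrow> 'u) \<Rightarrow> bool" where
  "null_hom C X Y h \<longleftrightarrow> (\<exists>P\<in>fg_modules C. projective C P \<and>
     (\<exists>u\<in>rhom C X P. \<exists>v\<in>rhom C P Y. \<forall>x\<in>carrier X. h x = v (u x)))"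

lemma null_homI:
  fixes X P Y :: "('c, 'u) rmodule"
  assumes "right_module C X" and "P \<in> fg_modules C" and "projective C P"
    and "rlin C X P u" and "rlin C P Y v" and "\<And>x. x \<in> carrier X \<Longrightarrow> h x = v (u x)"
  shows "null_hom C X Y h"
proof -
  have "right_module C P" using assms(3) by (simp add: projective_def)
  then have "restrict u (carrier X) \<in> rhom C X P" "restrict v (carrier P) \<in> rhom C P Y"
    using assms rhom_restrict by blast+
  moreover have "h x = restrict v (carrier P) (restrict u (carrier X) x)" if "x \<in> carrier X" for x
    using that assms(6) rlin_closed[OF assms(4)] by simp
  ultimately show ?thesis
    unfolding null_hom_def using assms(2,3) by blast
qed

lemma null_homE:
  fixes X Y :: "('c, 'u) rmodule"
  assumes "null_hom C X Y h"
  obtains P :: "('c, 'u) rmodule" and u v where "P \<in> fg_modules C" and "projective C P" and "rlin C X P u"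
    and "rlin C P Y v" and "\<And>x. x \<in> carrier X \<Longrightarrow> h x = v (u x)"
proof -
  obtain P u v where "P \<in> fg_modules C" "projective C P" "u \<in> rhom C X P" "v \<in> rhom C P Y"
    "\<forall>x\<in>carrier X. h x = v (u x)"
    using assms unfolding null_hom_def by blast
  then show thesis
    by (intro that[of P u v]) (simp_all add: rlin_if_rhom)
qed

lemma stable_rel_iff_null_hom:
  "(f, g) \<in> stable_rel C X Y \<longleftrightarrow> f \<in> rhom C X Y \<and> g \<in> rhom C X Y \<and> null_hom C X Y (\<lambda>x. f x \<ominus>\<^bsub>Y\<^esub> g x)"
  by (auto simp: stable_rel_def null_hom_def)

lemma null_hom_cong: "(\<And>x. x \<in> carrier X \<Longrightarrow> h x = h' x) \<Longrightarrow> null_hom C X Y h \<longleftrightarrow> null_hom C X Y h'"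
  by (simp add: null_hom_def cong: ball_cong)

text \<open>A stable hom-set contains the class of the zero map, so it has a single element exactly
  when every morphism is stably zero.\<close>

lemma is_singleton_stable_hom_iff:
  fixes X Y P :: "('c, 'u) rmodule" and C :: "('c, 'r) ring_scheme"
  assumes X: "right_module C X" and Y: "right_module C Y"
    and P: "P \<in> fg_modules C" "projective C P"
  shows "is_singleton (Hom (stable_cat C) X Y) \<longleftrightarrow> (\<forall>h\<in>rhom C X Y. null_hom C X Y h)"
proof -
  interpret X: right_module C X by fact
  interpret Y: right_module C Y by fact
  have P': "right_module C P" using P(2) by (simp add: projective_def)
  interpret P: right_module C P by fact
  define z where "z = (\<lambda>x\<in>carrier X. \<zero>\<^bsub>Y\<^esub>)"
  have zero_lin: "rlin C X N (\<lambda>x. \<zero>\<^bsub>N\<^esub>)" if "right_module C N" for N :: "('c, 'u) rmodule"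
  proof -
    interpret N: right_module C N by fact
    show ?thesis by (intro rlinI) (simp_all add: N.zero_ract)
  qed
  have PY: "rlin C P Y (\<lambda>x. \<zero>\<^bsub>Y\<^esub>)"
    by (intro rlinI) (simp_all add: Y.zero_ract)
  have z: "z \<in> rhom C X Y"
    unfolding z_def by (rule rhom_restrict[OF X zero_lin[OF Y]])
  have Hom: "Hom (stable_cat C) X Y = (\<lambda>f. stable_class C X Y f) ` rhom C X Y"
    by (auto simp: stable_cat_def quotient_def)
  show ?thesis
  proof
    assume "is_singleton (Hom (stable_cat C) X Y)"
    then obtain c where c: "Hom (stable_cat C) X Y = {c}"
      by (auto simp: is_singleton_def)
    \<comment> \<open>The zero map factors over \<open>P\<close>, so \<open>z\<close> is related to
      itself. Without a member in its class, equality of classes would give no information about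
      \<open>h\<close>.\<close>
    have "null_hom C X Y (\<lambda>x. z x \<ominus>\<^bsub>Y\<^esub> z x)"
      by (rule null_homI[OF X P zero_lin[OF P'] PY]) (simp add: z_def Y.M.minus_eq_zero_iff)
    then have zz: "z \<in> stable_class C X Y z"
      using z by (simp add: stable_rel_iff_null_hom)
    show "\<forall>h\<in>rhom C X Y. null_hom C X Y h"
    proof
      fix h assume h: "h \<in> rhom C X Y"
      then have "stable_class C X Y h \<in> {c}" "stable_class C X Y z \<in> {c}"
        using z unfolding c[symmetric] Hom by simp_all
      then have "stable_class C X Y h = stable_class C X Y z"
        by simp
      then have "null_hom C X Y (\<lambda>x. h x \<ominus>\<^bsub>Y\<^esub> z x)"
        using zz by (auto simp: stable_rel_iff_null_hom)
      moreover have "h x \<ominus>\<^bsub>Y\<^esub> z x = h x" if "x \<in> carrier X" for x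
        using that rlin_closed[OF rlin_if_rhom[OF h] that] Y.M.minus_equality[of "\<zero>\<^bsub>Y\<^esub>" "\<zero>\<^bsub>Y\<^esub>"]
        by (simp add: z_def Y.M.minus_eq)
      ultimately show "null_hom C X Y h"
        using null_hom_cong[of X "\<lambda>x. h x \<ominus>\<^bsub>Y\<^esub> z x" h C Y] by simp
    qed
  next
    assume null: "\<forall>h\<in>rhom C X Y. null_hom C X Y h"
    have "stable_class C X Y f = rhom C X Y" if f: "f \<in> rhom C X Y" for f
    proof -
      have "null_hom C X Y (\<lambda>x. f x \<ominus>\<^bsub>Y\<^esub> g x)" if g: "g \<in> rhom C X Y" for g
      proof -
        have "restrict (\<lambda>x. f x \<ominus>\<^bsub>Y\<^esub> g x) (carrier X) \<in> rhom C X Y"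
          by (intro rhom_restrict X rlin_diff Y rlin_if_rhom f g)
        then show ?thesis
          using bspec[OF null]
            null_hom_cong[of X "restrict (\<lambda>x. f x \<ominus>\<^bsub>Y\<^esub> g x) (carrier X)" "\<lambda>x. f x \<ominus>\<^bsub>Y\<^esub> g x" C Y]
          by simp
      qed
      then show ?thesis
        using f by (auto simp: stable_rel_iff_null_hom)
    qed
    then have "Hom (stable_cat C) X Y = {rhom C X Y}"
      unfolding Hom using z by auto
    then show "is_singleton (Hom (stable_cat C) X Y)"
      by simp
  qed
qed

lemma right_adjoint_is_singleton_iff:
  assumes "is_right_adjoint A B F G" and "X \<in> Obj A" and "Y \<in> Obj B"
  shows "is_singleton (Hom A X (on_obj G Y)) \<longleftrightarrow> is_singleton (Hom B (on_obj F X) Y)"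
proof -
  obtain \<phi> where "bij_betw \<phi> (Hom B (on_obj F X) Y) (Hom A X (on_obj G Y))"
    using assms unfolding is_right_adjoint_def by blast
  then show ?thesis
    by (simp add: is_singleton_altdef bij_betw_same_card)
qed

section \<open>Obstruction to a right adjoint\<close>

text \<open>
  The model is the path algebra of \<open>a : e \<rightarrow> f\<close> over \<open>k[\<epsilon>]\<close> with \<open>\<epsilon>\<^sup>2 = 0\<close>. The right ideals \<open>I\<^sub>U\<close>,
  \<open>I\<^sub>V\<close> and \<open>I\<^sub>Q\<close> below are the kernels of surjections from the ring to \<open>U\<close>, \<open>V\<close> and \<open>Q\<close>.
\<close>

locale dual_number_path_ring = ring C
  for C :: "('c, 'r) ring_scheme" (structure) +
  fixes e f a \<epsilon> :: 'c
  assumes fin: "finite (carrier C)"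
    and closed [simp]: "e \<in> carrier C" "f \<in> carrier C" "a \<in> carrier C" "\<epsilon> \<in> carrier C"
    and one_eq: "\<one> = e \<oplus> f"
    and mults [simp]: "e \<otimes> e = e" "f \<otimes> f = f" "e \<otimes> f = \<zero>" "f \<otimes> e = \<zero>" "e \<otimes> a = a" "a \<otimes> f = a" "\<epsilon> \<otimes> \<epsilon> = \<zero>"
    and no_f_e: "r \<in> carrier C \<Longrightarrow> f \<otimes> r \<otimes> e = \<zero>"
    and eps_central: "r \<in> carrier C \<Longrightarrow> \<epsilon> \<otimes> r = r \<otimes> \<epsilon>"
    and eps_f_nonzero: "\<epsilon> \<otimes> f \<noteq> \<zero>"
    and eps_annihilator: "\<lbrakk>r \<in> carrier C; r \<otimes> \<epsilon> = \<zero>\<rbrakk> \<Longrightarrow> \<exists>t\<in>carrier C. r = t \<otimes> \<epsilon>"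
    and a_eps_f_annihilator: "\<lbrakk>r \<in> carrier C; r \<otimes> a = r \<otimes> (\<epsilon> \<otimes> f)\<rbrakk> \<Longrightarrow>
      \<exists>x\<in>carrier C. \<exists>z\<in>carrier C. r \<otimes> f = x \<otimes> a \<oplus> z \<otimes> \<epsilon> \<and> r \<otimes> e = x \<otimes> \<epsilon>"
    and a_eps_f_left: "\<lbrakk>r \<in> carrier C; (a \<ominus> \<epsilon> \<otimes> f) \<otimes> r = \<zero>\<rbrakk> \<Longrightarrow> f \<otimes> r = \<zero>"
begin

text \<open>Left multiplication by \<open>\<epsilon> \<otimes> f\<close> maps the ring onto the
  right ideal \<open>\<epsilon> f C\<close>, a copy of (0 \<rightarrow> k), with kernel
  \<open>I\<^sub>U\<close>. In the same way \<open>I\<^sub>V\<close> belongs to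
  \<open>\<epsilon> e C\<close>, a copy of (k = k).\<close>

definition "I\<^sub>U = {r \<in> carrier C. \<epsilon> \<otimes> f \<otimes> r = \<zero>}"
definition "I\<^sub>V = {r \<in> carrier C. \<epsilon> \<otimes> e \<otimes> r = \<zero>}"
text \<open>Modulo \<open>w\<close> the arrow sends the e-part of the generator to \<epsilon> times
  its f-part, which is the structure map of Q.\<close>

definition "w = a \<ominus> \<epsilon> \<otimes> f"
definition "I\<^sub>Q = {w \<otimes> r | r. r \<in> carrier C}"

section \<open>Arithmetic of \<open>w\<close> and of the three right ideals\<close>

lemma w_closed [simp]: "w \<in> carrier C"
  by (simp add: w_def)

lemma w_f: "w \<otimes> f = w"
  by (simp add: w_def minus_eq l_distr l_minus m_assoc)

text \<open>Left multiplication by \<open>w\<close> is injective on \<open>f C\<close>. Together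
  with \<open>w_f\<close> this gives \<open>w C \<cong> f C\<close>, and so the syzygy
  \<open>I\<^sub>Q\<close> of Q is projective.\<close>

lemma w_cancel:
  assumes "r \<in> carrier C" and "t \<in> carrier C" and "w \<otimes> r = w \<otimes> t"
  shows "f \<otimes> r = f \<otimes> t"
proof -
  have "w \<otimes> (r \<ominus> t) = \<zero>"
    using assms by (simp add: minus_eq r_distr r_minus r_neg)
  then have "f \<otimes> (r \<ominus> t) = \<zero>"
    using a_eps_f_left assms(1,2) by (simp add: w_def)
  then have "f \<otimes> r \<ominus> f \<otimes> t = \<zero>"
    using assms(1,2) by (simp add: minus_eq r_distr r_minus)
  then show ?thesis
    using assms(1,2) minus_eq_zero_iff[of "f \<otimes> r" "f \<otimes> t"] by simp
qed

lemma rsubmodule_left_annihilator: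
  assumes "c \<in> carrier C"
  shows "rsubmodule C {r \<in> carrier C. c \<otimes> r = \<zero>} (regular_module C)"
  using assms by (auto simp: rsubmodule_def r_distr simp flip: m_assoc)

lemma rsubmodule_I\<^sub>U: "rsubmodule C I\<^sub>U (regular_module C)"
  and rsubmodule_I\<^sub>V: "rsubmodule C I\<^sub>V (regular_module C)"
  unfolding I\<^sub>U_def I\<^sub>V_def by (rule rsubmodule_left_annihilator; simp)+

lemma rsubmodule_I\<^sub>Q: "rsubmodule C I\<^sub>Q (regular_module C)"
  unfolding rsubmodule_def
proof (intro conjI ballI)
  show "\<zero>\<^bsub>regular_module C\<^esub> \<in> I\<^sub>Q"
    by (auto simp: I\<^sub>Q_def intro!: exI[of _ \<zero>])
next
  fix m n assume "m \<in> I\<^sub>Q" "n \<in> I\<^sub>Q"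
  then obtain r s where "r \<in> carrier C" "m = w \<otimes> r" "s \<in> carrier C" "n = w \<otimes> s"
    by (auto simp: I\<^sub>Q_def)
  then show "m \<oplus>\<^bsub>regular_module C\<^esub> n \<in> I\<^sub>Q"
    by (auto simp: I\<^sub>Q_def r_distr intro!: exI[of _ "r \<oplus> s"])
next
  fix m s assume "m \<in> I\<^sub>Q" "s \<in> carrier C"
  then obtain r where "r \<in> carrier C" "m = w \<otimes> r"
    by (auto simp: I\<^sub>Q_def)
  with \<open>s \<in> carrier C\<close> show "m \<lhd>\<^bsub>regular_module C\<^esub> s \<in> I\<^sub>Q"
    by (auto simp: I\<^sub>Q_def m_assoc intro!: exI[of _ "r \<otimes> s"])
qed (auto simp: I\<^sub>Q_def)

text \<open>Since \<open>\<epsilon>\<close> is central, \<open>e \<otimes> r\<close> is killed by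
  \<open>\<epsilon>\<close> from the right as well, and over k[\<epsilon>] the kernel of \<epsilon>
  on the ring is its image.\<close>

lemma eps_e_mult_eq_zero:
  assumes "r \<in> carrier C" and "\<epsilon> \<otimes> e \<otimes> r = \<zero>"
  shows "\<exists>t\<in>carrier C. e \<otimes> r = t \<otimes> \<epsilon>"
  using eps_annihilator[of "e \<otimes> r"] assms by (auto simp: eps_central[symmetric] m_assoc)

lemma eps_f_mult_eq_zero:
  assumes "r \<in> carrier C" and "\<epsilon> \<otimes> f \<otimes> r = \<zero>"
  shows "\<exists>t\<in>carrier C. f \<otimes> r = t \<otimes> \<epsilon>"
  using eps_annihilator[of "f \<otimes> r"] assms by (auto simp: eps_central[symmetric] m_assoc)

subsection \<open>Projective modules\<close>

text \<open>A finitely generated projective module is free over k[\<epsilon>], where kernel and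
  image of \<epsilon> agree. Concretely, the coordinates of \<open>\<iota> p\<close> are divided by
  \<open>\<epsilon>\<close> one by one and the result is projected back to \<open>P\<close>.\<close>

lemma projective_eps_annihilator:
  fixes P :: "('c, 'u) rmodule"
  assumes inf: "infinite (UNIV :: 'u set)" and P: "projective C P" "P \<in> fg_modules C"
    and p: "p \<in> carrier P" "p \<lhd>\<^bsub>P\<^esub> \<epsilon> = \<zero>\<^bsub>P\<^esub>"
  obtains q where "q \<in> carrier P" and "p = q \<lhd>\<^bsub>P\<^esub> \<epsilon>"
proof -
  obtain S :: "'u set" and \<iota> \<pi> where \<iota>: "rlin C P (free_module C S) \<iota>"
    and \<pi>: "rlin C (free_module C S) P \<pi>" and \<pi>\<iota>: "\<And>x. x \<in> carrier P \<Longrightarrow> \<pi> (\<iota> x) = x"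
    by (rule projective_retract_of_free[OF P fin inf]) blast
  have P': "right_module C P" using P(1) by (simp add: projective_def)
  have comp: "\<iota> p s \<in> carrier C" if "s \<in> S" for s
    using rlin_closed[OF \<iota> p(1)] that by (auto simp: free_module_simps)
  have "\<iota> p \<lhd>\<^bsub>free_module C S\<^esub> \<epsilon> = \<zero>\<^bsub>free_module C S\<^esub>"
    using rlin_ract[OF \<iota> p(1), of \<epsilon>] rlin_zero[OF P' right_module_free \<iota>] p(2) by simp
  then have "\<iota> p s \<otimes> \<epsilon> = \<zero>" if "s \<in> S" for s
    using that by (auto simp: free_module_simps dest: fun_cong[of _ _ s])
  then have "\<forall>s\<in>S. \<exists>t\<in>carrier C. \<iota> p s = t \<otimes> \<epsilon>"
    using eps_annihilator comp by blast
  then obtain t where t: "\<And>s. s \<in> S \<Longrightarrow> t s \<in> carrier C \<and> \<iota> p s = t s \<otimes> \<epsilon>"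
    by metis
  have t_mem: "restrict t S \<in> carrier (free_module C S)"
    using t by (auto simp: free_module_simps)
  have "\<iota> p = restrict t S \<lhd>\<^bsub>free_module C S\<^esub> \<epsilon>"
    using rlin_closed[OF \<iota> p(1)] t
    by (intro extensionalityI[of _ S]) (auto simp: free_module_simps PiE_def)
  then have "p = \<pi> (restrict t S) \<lhd>\<^bsub>P\<^esub> \<epsilon>"
    using \<pi>\<iota>[OF p(1)] rlin_ract[OF \<pi> t_mem, of \<epsilon>] by simp
  then show thesis
    using that rlin_closed[OF \<pi> t_mem] by blast
qed

text \<open>The elements \<open>p\<close> in question are the images of the generator under
  morphisms from Q to \<open>P\<close>. One element \<open>x\<close> governs both parts of
  \<open>p\<close>, the f-part only up to a multiple of \<epsilon>; this link is what
  \<open>hom_U_null\<close> exploits. It holds coordinatewise in the ring and passes to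
  retracts.\<close>

lemma projective_a_eps_f_annihilator:
  fixes P :: "('c, 'u) rmodule"
  assumes inf: "infinite (UNIV :: 'u set)" and P: "projective C P" "P \<in> fg_modules C"
    and p: "p \<in> carrier P" "p \<lhd>\<^bsub>P\<^esub> a = p \<lhd>\<^bsub>P\<^esub> (\<epsilon> \<otimes> f)"
  obtains x z where "x \<in> carrier P" and "z \<in> carrier P"
    and "p \<lhd>\<^bsub>P\<^esub> f = x \<lhd>\<^bsub>P\<^esub> a \<oplus>\<^bsub>P\<^esub> z \<lhd>\<^bsub>P\<^esub> \<epsilon>" and "p \<lhd>\<^bsub>P\<^esub> e = x \<lhd>\<^bsub>P\<^esub> \<epsilon>"
proof -
  obtain S :: "'u set" and \<iota> \<pi> where \<iota>: "rlin C P (free_module C S) \<iota>"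
    and \<pi>: "rlin C (free_module C S) P \<pi>" and \<pi>\<iota>: "\<And>x. x \<in> carrier P \<Longrightarrow> \<pi> (\<iota> x) = x"
    by (rule projective_retract_of_free[OF P fin inf]) blast
  define F where "F = free_module C S"
  note \<iota> = \<iota>[folded F_def] and \<pi> = \<pi>[folded F_def]
  interpret P: right_module C P using P(1) by (simp add: projective_def)
  interpret F: right_module C F unfolding F_def by (rule right_module_free)
  have comp: "\<iota> p s \<in> carrier C" if "s \<in> S" for s
    using rlin_closed[OF \<iota> p(1)] that by (auto simp: free_module_simps F_def)
  have "\<iota> p \<lhd>\<^bsub>F\<^esub> a = \<iota> p \<lhd>\<^bsub>F\<^esub> (\<epsilon> \<otimes> f)"
    using rlin_ract[OF \<iota> p(1), of a] rlin_ract[OF \<iota> p(1), of "\<epsilon> \<otimes> f"] p(2) by simp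
  then have "\<iota> p s \<otimes> a = \<iota> p s \<otimes> (\<epsilon> \<otimes> f)" if "s \<in> S" for s
    using that by (auto simp: free_module_simps F_def dest: fun_cong[of _ _ s])
  then have "\<forall>s\<in>S. \<exists>x\<in>carrier C. \<exists>z\<in>carrier C. \<iota> p s \<otimes> f = x \<otimes> a \<oplus> z \<otimes> \<epsilon> \<and> \<iota> p s \<otimes> e = x \<otimes> \<epsilon>"
    using a_eps_f_annihilator comp by blast
  then obtain x z where xz: "\<And>s. s \<in> S \<Longrightarrow> x s \<in> carrier C \<and> z s \<in> carrier C \<and>
      \<iota> p s \<otimes> f = x s \<otimes> a \<oplus> z s \<otimes> \<epsilon> \<and> \<iota> p s \<otimes> e = x s \<otimes> \<epsilon>"
    by metis
  have x: "restrict x S \<in> carrier F" and z: "restrict z S \<in> carrier F"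
    using xz by (auto simp: free_module_simps F_def)
  have "\<iota> p \<lhd>\<^bsub>F\<^esub> f = restrict x S \<lhd>\<^bsub>F\<^esub> a \<oplus>\<^bsub>F\<^esub> restrict z S \<lhd>\<^bsub>F\<^esub> \<epsilon>"
    and "\<iota> p \<lhd>\<^bsub>F\<^esub> e = restrict x S \<lhd>\<^bsub>F\<^esub> \<epsilon>"
    using xz by (auto simp: free_module_simps F_def intro!: restrict_ext)
  then have "\<pi> (\<iota> p) \<lhd>\<^bsub>P\<^esub> f = \<pi> (restrict x S) \<lhd>\<^bsub>P\<^esub> a \<oplus>\<^bsub>P\<^esub> \<pi> (restrict z S) \<lhd>\<^bsub>P\<^esub> \<epsilon>"
    and "\<pi> (\<iota> p) \<lhd>\<^bsub>P\<^esub> e = \<pi> (restrict x S) \<lhd>\<^bsub>P\<^esub> \<epsilon>"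
    using x z rlin_closed[OF \<iota> p(1)]
    by (simp_all add: F.ract_closed flip: rlin_ract[OF \<pi>] rlin_add[OF \<pi>])
  then show thesis
    using that[of "\<pi> (restrict x S)" "\<pi> (restrict z S)"] rlin_closed[OF \<pi>] x z \<pi>\<iota>[OF p(1)] by simp
qed

subsection \<open>Syzygies of the test modules\<close>

text \<open>Schanuel's lemma reduces the claim to \<open>w C \<cong> f C\<close>. The lift is built
  on the two summands of \<open>k = s (i k) \<oplus> b (d (i k))\<close> separately: the first is
  lifted through \<open>P\<close>, the second through a preimage \<open>n\<close> of
  \<open>h (b w)\<close>.\<close>

lemma syzygy_Q_projective:
  fixes P :: "('c, 'u) rmodule"
  assumes inf: "infinite (UNIV :: 'u set)" and X: "presents C I\<^sub>Q X \<rho>" and P: "projective C P"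
    and K: "right_module C K" and ex: "short_exact C K P X i p"
  shows "projective C K"
  unfolding projective_def
proof (intro conjI allI impI K)
  fix M N :: "('c, 'u) rmodule" and g h
  assume "right_module C M \<and> right_module C N \<and> g \<in> rhom C M N \<and> g ` carrier M = carrier N \<and> h \<in> rhom C K N"
  then have M: "right_module C M" and N: "right_module C N" and g: "rlin C M N g"
    and surj: "g ` carrier M = carrier N" and h: "h \<in> rhom C K N" by (auto intro: rlin_if_rhom)
  note h' = rlin_if_rhom[OF h]
  interpret K: right_module C K by fact
  interpret M: right_module C M by fact
  interpret N: right_module C N by fact
  have i: "rlin C K P i"
    using ex by (auto simp: short_exact_def intro: rlin_if_rhom)
  obtain d s b where d: "rlin C P (regular_module C) d" and s: "rlin C P K s"
    and decomp: "\<And>k. k \<in> carrier K \<Longrightarrow> d (i k) \<in> carrier C \<and> d (i k) \<in> I\<^sub>Q \<and> k = s (i k) \<oplus>\<^bsub>K\<^esub> b (d (i k))"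
    and b: "\<And>r. \<lbrakk>r \<in> carrier C; r \<in> I\<^sub>Q\<rbrakk> \<Longrightarrow> b r \<in> carrier K"
    and b_ract: "\<And>r t. \<lbrakk>r \<in> carrier C; r \<in> I\<^sub>Q; t \<in> carrier C\<rbrakk> \<Longrightarrow> b (r \<otimes> t) = b r \<lhd>\<^bsub>K\<^esub> t"
    by (rule syzygy_comparison[OF inf fin X P K ex]) blast
  obtain l where l: "rlin C P M l" "\<And>x. x \<in> carrier P \<Longrightarrow> g (l x) = h (s x)"
    using projective_lift_same[OF P M N g surj rlin_comp[OF s h']] by metis
  have w: "w \<in> I\<^sub>Q"
    by (auto simp: I\<^sub>Q_def intro!: exI[of _ \<one>])
  have "h (b w) \<in> g ` carrier M"
    using b[OF _ w] rlin_closed[OF h'] surj by simp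
  then obtain n where n: "n \<in> carrier M" "g n = h (b w)" by force
  \<comment> \<open>A quotient of \<open>d (i k)\<close> by \<open>w\<close> is unique only up to
    the annihilator of \<open>w\<close>. By \<open>w_cancel\<close> the product
    \<open>f \<otimes> c k\<close> is independent of the choice and thus linear in
    \<open>k\<close>.\<close>
  define c where "c k = (SOME r. r \<in> carrier C \<and> w \<otimes> r = d (i k))" for k
  have c: "c k \<in> carrier C" "w \<otimes> c k = d (i k)" if "k \<in> carrier K" for k
  proof -
    have "\<exists>r. r \<in> carrier C \<and> w \<otimes> r = d (i k)"
      using decomp[OF that] by (auto simp: I\<^sub>Q_def)
    from someI_ex[OF this] show "c k \<in> carrier C" "w \<otimes> c k = d (i k)"
      by (auto simp: c_def)
  qed
  have d_add: "d (i (k \<oplus>\<^bsub>K\<^esub> k')) = d (i k) \<oplus> d (i k')" if "k \<in> carrier K" "k' \<in> carrier K" for k k'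
    using rlin_add[OF rlin_comp[OF i d] that] by simp
  have d_ract: "d (i (k \<lhd>\<^bsub>K\<^esub> r)) = d (i k) \<otimes> r" if "k \<in> carrier K" "r \<in> carrier C" for k r
    using rlin_ract[OF rlin_comp[OF i d] that] by simp
  have fc_lin: "rlin C K (regular_module C) (\<lambda>k. f \<otimes> c k)"
  proof (rule rlinI)
    fix k k' assume k: "k \<in> carrier K" "k' \<in> carrier K"
    have "w \<otimes> c (k \<oplus>\<^bsub>K\<^esub> k') = w \<otimes> (c k \<oplus> c k')"
      using k by (simp add: c d_add r_distr)
    then show "f \<otimes> c (k \<oplus>\<^bsub>K\<^esub> k') = f \<otimes> c k \<oplus>\<^bsub>regular_module C\<^esub> f \<otimes> c k'"
      using w_cancel[of "c (k \<oplus>\<^bsub>K\<^esub> k')" "c k \<oplus> c k'"] k by (simp add: c r_distr)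
  next
    fix k r assume k: "k \<in> carrier K" "r \<in> carrier C"
    have "w \<otimes> c (k \<lhd>\<^bsub>K\<^esub> r) = w \<otimes> (c k \<otimes> r)"
      using k by (simp add: c d_ract K.ract_closed flip: m_assoc)
    then show "f \<otimes> c (k \<lhd>\<^bsub>K\<^esub> r) = f \<otimes> c k \<lhd>\<^bsub>regular_module C\<^esub> r"
      using w_cancel[of "c (k \<lhd>\<^bsub>K\<^esub> r)" "c k \<otimes> r"] k by (simp add: c K.ract_closed m_assoc)
  qed (simp add: c)
  have n_lin: "rlin C (regular_module C) M (\<lambda>r. n \<lhd>\<^bsub>M\<^esub> r)"
    by (intro rlinI) (simp_all add: n(1) M.ract_closed M.ract_add_right M.ract_mult)
  define l' where "l' k = l (i k) \<oplus>\<^bsub>M\<^esub> n \<lhd>\<^bsub>M\<^esub> (f \<otimes> c k)" for k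
  have l': "rlin C K M l'"
    unfolding l'_def by (rule rlin_sum[OF M rlin_comp[OF i l(1)] rlin_comp[OF fc_lin n_lin]])
  have "g (l' k) = h k" if k: "k \<in> carrier K" for k
  proof -
    have ik: "i k \<in> carrier P" using rlin_closed[OF i k] .
    have dk: "d (i k) = w \<otimes> (f \<otimes> c k)"
      using c[OF k] w_f by (simp flip: m_assoc)
    have "b (d (i k)) = b w \<lhd>\<^bsub>K\<^esub> (f \<otimes> c k)"
      unfolding dk using w c(1)[OF k] by (intro b_ract) simp_all
    then have "k = s (i k) \<oplus>\<^bsub>K\<^esub> b w \<lhd>\<^bsub>K\<^esub> (f \<otimes> c k)"
      using decomp[OF k] by simp
    then have "h k = h (s (i k) \<oplus>\<^bsub>K\<^esub> b w \<lhd>\<^bsub>K\<^esub> (f \<otimes> c k))"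
      by (rule arg_cong)
    also have "\<dots> = h (s (i k)) \<oplus>\<^bsub>N\<^esub> h (b w) \<lhd>\<^bsub>N\<^esub> (f \<otimes> c k)"
      using b[OF _ w] c(1)[OF k] rlin_closed[OF s ik]
      by (simp add: rlin_add[OF h'] rlin_ract[OF h'] K.ract_closed)
    also have "\<dots> = g (l' k)"
      using n c(1)[OF k] rlin_closed[OF l(1) ik] l(2)[OF ik]
      by (simp add: l'_def rlin_add[OF g] rlin_ract[OF g] M.ract_closed)
    finally show ?thesis by simp
  qed
  then have "compose (carrier K) g (restrict l' (carrier K)) = h"
    using h by (intro extensionalityI[of _ "carrier K"]) (simp_all add: compose_def rhom_iff_rlin)
  then show "\<exists>k\<in>rhom C K M. compose (carrier K) g k = h"
    using rhom_restrict[OF K l'] by blast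
qed

text \<open>The right ideal \<open>I\<^sub>V\<close> is generated by
  \<open>e \<otimes> \<epsilon>\<close> and \<open>f\<close>. A morphism to \<open>U\<close> kills
  the first generator, as \<open>U\<close> has no e-part, and is then given by
  \<open>r \<mapsto> h (b f) \<lhd> r\<close>, a formula that makes sense on the whole ring.\<close>

lemma hom_syzygy_V_null:
  fixes P :: "('c, 'u) rmodule"
  assumes inf: "infinite (UNIV :: 'u set)" and X: "presents C I\<^sub>V X \<rho>"
    and P: "projective C P" "P \<in> fg_modules C" and K: "right_module C K"
    and ex: "short_exact C K P X i p" and U: "right_module C U"
    and Ue: "\<And>u. u \<in> carrier U \<Longrightarrow> u \<lhd>\<^bsub>U\<^esub> e = \<zero>\<^bsub>U\<^esub>" and h: "rlin C K U h"
  shows "null_hom C K U h"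
proof -
  interpret K: right_module C K by fact
  interpret U: right_module C U by fact
  have i: "rlin C K P i"
    using ex by (auto simp: short_exact_def intro: rlin_if_rhom)
  obtain d s b where d: "rlin C P (regular_module C) d" and s: "rlin C P K s"
    and decomp: "\<And>k. k \<in> carrier K \<Longrightarrow> d (i k) \<in> carrier C \<and> d (i k) \<in> I\<^sub>V \<and> k = s (i k) \<oplus>\<^bsub>K\<^esub> b (d (i k))"
    and b: "\<And>r. \<lbrakk>r \<in> carrier C; r \<in> I\<^sub>V\<rbrakk> \<Longrightarrow> b r \<in> carrier K"
    and b_add: "\<And>r t. \<lbrakk>r \<in> carrier C; r \<in> I\<^sub>V; t \<in> carrier C; t \<in> I\<^sub>V\<rbrakk> \<Longrightarrow> b (r \<oplus> t) = b r \<oplus>\<^bsub>K\<^esub> b t"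
    and b_ract: "\<And>r t. \<lbrakk>r \<in> carrier C; r \<in> I\<^sub>V; t \<in> carrier C\<rbrakk> \<Longrightarrow> b (r \<otimes> t) = b r \<lhd>\<^bsub>K\<^esub> t"
    by (rule syzygy_comparison[OF inf fin X P(1) K ex]) blast
  have f: "f \<in> I\<^sub>V"
    by (simp add: I\<^sub>V_def m_assoc)
  have "\<epsilon> \<otimes> e \<otimes> (e \<otimes> \<epsilon>) = \<epsilon> \<otimes> (e \<otimes> \<epsilon>)"
    by (simp add: m_assoc flip: m_assoc[of e e])
  also have "\<dots> = \<zero>"
    by (simp flip: eps_central m_assoc)
  finally have e_eps: "e \<otimes> \<epsilon> \<in> I\<^sub>V"
    by (simp add: I\<^sub>V_def)
  \<comment> \<open>The generator is fixed by \<open>e\<close>, hence so is its image under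
    \<open>h\<close> and \<open>b\<close>; but \<open>e\<close> acts as zero on
    \<open>U\<close>.\<close>
  have "(e \<otimes> \<epsilon>) \<otimes> e = e \<otimes> \<epsilon>"
    by (simp add: m_assoc eps_central flip: m_assoc[of e e])
  then have "b (e \<otimes> \<epsilon>) = b (e \<otimes> \<epsilon>) \<lhd>\<^bsub>K\<^esub> e"
    using b_ract[OF _ e_eps, of e] by simp
  then have "h (b (e \<otimes> \<epsilon>)) = h (b (e \<otimes> \<epsilon>)) \<lhd>\<^bsub>U\<^esub> e"
    using rlin_ract[OF h b[OF _ e_eps], of e] by simp
  then have hb_e_eps: "h (b (e \<otimes> \<epsilon>)) = \<zero>\<^bsub>U\<^esub>"
    using Ue rlin_closed[OF h b[OF _ e_eps]] by simp
  have hb: "h (b r) = h (b f) \<lhd>\<^bsub>U\<^esub> r" if r: "r \<in> carrier C" "r \<in> I\<^sub>V" for r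
  proof -
    obtain t where t: "t \<in> carrier C" "e \<otimes> r = t \<otimes> \<epsilon>"
      using eps_e_mult_eq_zero[of r] r by (auto simp: I\<^sub>V_def)
    have "e \<otimes> r = e \<otimes> (e \<otimes> r)"
      using r(1) by (simp flip: m_assoc)
    also have "\<dots> = e \<otimes> \<epsilon> \<otimes> t"
      using t by (simp add: m_assoc eps_central)
    finally have er: "e \<otimes> r = e \<otimes> \<epsilon> \<otimes> t" .
    have er_mem: "e \<otimes> \<epsilon> \<otimes> t \<in> I\<^sub>V" and fr_mem: "f \<otimes> r \<in> I\<^sub>V"
      using rsubmodule_I\<^sub>V e_eps f t(1) r(1) by (auto simp: rsubmodule_def)
    have "r = e \<otimes> \<epsilon> \<otimes> t \<oplus> f \<otimes> r"
      using r(1) one_eq by (metis er closed(1,2) l_distr l_one)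
    then have "b r = b (e \<otimes> \<epsilon> \<otimes> t \<oplus> f \<otimes> r)"
      by (rule arg_cong)
    also have "\<dots> = b (e \<otimes> \<epsilon>) \<lhd>\<^bsub>K\<^esub> t \<oplus>\<^bsub>K\<^esub> b f \<lhd>\<^bsub>K\<^esub> r"
      using er_mem fr_mem e_eps f t(1) r(1) by (simp add: b_add b_ract)
    finally have "h (b r) = h (b (e \<otimes> \<epsilon>)) \<lhd>\<^bsub>U\<^esub> t \<oplus>\<^bsub>U\<^esub> h (b f) \<lhd>\<^bsub>U\<^esub> r"
      using b e_eps f t(1) r(1) by (simp add: rlin_add[OF h] rlin_ract[OF h] K.ract_closed)
    then show ?thesis
      using hb_e_eps t(1) r(1) rlin_closed[OF h b[OF _ f]] by (simp add: U.zero_ract U.ract_closed)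
  qed
  have u: "h (b f) \<in> carrier U"
    using rlin_closed[OF h b[OF _ f]] by simp
  have "rlin C (regular_module C) U (\<lambda>r. h (b f) \<lhd>\<^bsub>U\<^esub> r)"
    by (intro rlinI) (simp_all add: u U.ract_closed U.ract_add_right U.ract_mult)
  \<comment> \<open>An extension of \<open>h\<close> along \<open>i\<close> to the projective module
    \<open>P\<close>: \<open>s\<close> accounts for one summand of the decomposition of
    \<open>k\<close>, and \<open>d\<close> for the other.\<close>
  then have ext: "rlin C P U (\<lambda>x. h (s x) \<oplus>\<^bsub>U\<^esub> h (b f) \<lhd>\<^bsub>U\<^esub> d x)"
    by (intro rlin_sum[OF U] rlin_comp[OF s h] rlin_comp[OF d])
  show ?thesis
  proof (rule null_homI[OF K P(2,1) i ext])
    fix k assume k: "k \<in> carrier K"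
    have dk: "d (i k) \<in> carrier C" "d (i k) \<in> I\<^sub>V" and k_eq: "k = s (i k) \<oplus>\<^bsub>K\<^esub> b (d (i k))"
      using decomp[OF k] by auto
    have "h k = h (s (i k) \<oplus>\<^bsub>K\<^esub> b (d (i k)))"
      using k_eq by (rule arg_cong)
    also have "\<dots> = h (s (i k)) \<oplus>\<^bsub>U\<^esub> h (b (d (i k)))"
      using rlin_closed[OF s rlin_closed[OF i k]] b[OF dk] by (rule rlin_add[OF h])
    finally show "h k = h (s (i k)) \<oplus>\<^bsub>U\<^esub> h (b f) \<lhd>\<^bsub>U\<^esub> d (i k)"
      using hb[OF dk] by simp
  qed
qed

text \<open>The morphism divides the f-part of \<open>d (i k)\<close> by \<epsilon>; it realises
  \<Omega> U = U up to projective summands. It is nonzero at an element killed by \<epsilon>. In a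
  projective module such an element is a multiple of \<epsilon>, and \<open>U\<close> kills all
  multiples of \<epsilon>, so the morphism cannot be null.\<close>

lemma ex_hom_syzygy_U_not_null:
  fixes P :: "('c, 'u) rmodule"
  assumes inf: "infinite (UNIV :: 'u set)" and U: "presents C I\<^sub>U U \<rho>"
    and P: "projective C P" and K: "right_module C K" and ex: "short_exact C K P U i p"
  shows "\<exists>h\<in>rhom C K U. \<not> null_hom C K U h"
proof -
  interpret K: right_module C K by fact
  interpret U: right_module C U using presents_module[OF U] .
  note \<rho> = presents_rlin[OF U]
  have i: "rlin C K P i"
    using ex by (auto simp: short_exact_def intro: rlin_if_rhom)
  obtain d s b where d: "rlin C P (regular_module C) d" and s: "rlin C P K s"
    and decomp: "\<And>k. k \<in> carrier K \<Longrightarrow> d (i k) \<in> carrier C \<and> d (i k) \<in> I\<^sub>U \<and> k = s (i k) \<oplus>\<^bsub>K\<^esub> b (d (i k))"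
    and b: "\<And>r. \<lbrakk>r \<in> carrier C; r \<in> I\<^sub>U\<rbrakk> \<Longrightarrow> b r \<in> carrier K"
    and b_ract: "\<And>r t. \<lbrakk>r \<in> carrier C; r \<in> I\<^sub>U; t \<in> carrier C\<rbrakk> \<Longrightarrow> b (r \<otimes> t) = b r \<lhd>\<^bsub>K\<^esub> t"
    and db: "\<And>r. \<lbrakk>r \<in> carrier C; r \<in> I\<^sub>U\<rbrakk> \<Longrightarrow> \<exists>c\<in>carrier C. c \<ominus> \<one> \<in> I\<^sub>U \<and> d (i (b r)) = c \<otimes> r"
    by (rule syzygy_comparison[OF inf fin U P K ex]) blast
  \<comment> \<open>\<open>\<rho>\<close> depends on \<open>r\<close> only through
    \<open>f \<otimes> (r \<otimes> \<epsilon>)\<close>, so the ambiguity in dividing by \<epsilon>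
    disappears in \<open>U\<close>.\<close>
  have \<rho>_eq: "\<rho> r = \<rho> t" if "r \<in> carrier C" "t \<in> carrier C" "f \<otimes> (r \<otimes> \<epsilon>) = f \<otimes> (t \<otimes> \<epsilon>)" for r t
  proof -
    have "\<epsilon> \<otimes> f \<otimes> (r \<ominus> t) = f \<otimes> (r \<otimes> \<epsilon>) \<ominus> f \<otimes> (t \<otimes> \<epsilon>)"
      using that(1,2) by (simp add: minus_eq r_distr r_minus eps_central m_assoc)
    then have "r \<ominus> t \<in> I\<^sub>U"
      using that by (simp add: I\<^sub>U_def minus_eq r_neg)
    then show ?thesis
      using that rlin_eq_iff_minus_in_kernel[OF right_module_regular presents_module[OF U] \<rho>, of r t]
        presents_kernel[OF U] by simp
  qed
  define c where "c k = (SOME r. r \<in> carrier C \<and> f \<otimes> d (i k) = r \<otimes> \<epsilon>)" for k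
  have c: "c k \<in> carrier C" "f \<otimes> d (i k) = c k \<otimes> \<epsilon>" if "k \<in> carrier K" for k
  proof -
    have "\<exists>r. r \<in> carrier C \<and> f \<otimes> d (i k) = r \<otimes> \<epsilon>"
      using eps_f_mult_eq_zero[of "d (i k)"] decomp[OF that] by (auto simp: I\<^sub>U_def)
    from someI_ex[OF this] show "c k \<in> carrier C" "f \<otimes> d (i k) = c k \<otimes> \<epsilon>"
      by (auto simp: c_def)
  qed
  have dk: "d (i k) \<in> carrier C" if "k \<in> carrier K" for k
    using decomp[OF that] by simp
  have f_c: "f \<otimes> (c k \<otimes> \<epsilon>) = f \<otimes> d (i k)" if "k \<in> carrier K" for k
    using that dk[OF that] by (simp flip: c(2) m_assoc)
  have d_add: "d (i (k \<oplus>\<^bsub>K\<^esub> k')) = d (i k) \<oplus> d (i k')" if "k \<in> carrier K" "k' \<in> carrier K" for k k'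
    using rlin_add[OF rlin_comp[OF i d] that] by simp
  have d_ract: "d (i (k \<lhd>\<^bsub>K\<^esub> r)) = d (i k) \<otimes> r" if "k \<in> carrier K" "r \<in> carrier C" for k r
    using rlin_ract[OF rlin_comp[OF i d] that] by simp
  have \<rho>_add: "\<rho> (r \<oplus> t) = \<rho> r \<oplus>\<^bsub>U\<^esub> \<rho> t" and \<rho>_ract: "\<rho> (r \<otimes> t) = \<rho> r \<lhd>\<^bsub>U\<^esub> t"
    if "r \<in> carrier C" "t \<in> carrier C" for r t
    using rlin_add[OF \<rho>, of r t] rlin_ract[OF \<rho>, of r t] that by simp_all
  define h where "h k = \<rho> (c k)" for k
  have h: "rlin C K U h"
  proof (rule rlinI)
    show "h k \<in> carrier U" if "k \<in> carrier K" for k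
      using c(1)[OF that] rlin_closed[OF \<rho>] by (simp add: h_def)
  next
    fix k k' assume k: "k \<in> carrier K" "k' \<in> carrier K"
    have "\<rho> (c (k \<oplus>\<^bsub>K\<^esub> k')) = \<rho> (c k \<oplus> c k')"
      using k by (intro \<rho>_eq) (simp_all add: c(1) f_c d_add dk l_distr r_distr)
    then show "h (k \<oplus>\<^bsub>K\<^esub> k') = h k \<oplus>\<^bsub>U\<^esub> h k'"
      using k by (simp add: h_def c(1) \<rho>_add)
  next
    fix k r assume k: "k \<in> carrier K" "r \<in> carrier C"
    have "f \<otimes> (c k \<otimes> r \<otimes> \<epsilon>) = f \<otimes> (c k \<otimes> \<epsilon>) \<otimes> r"
      using k c(1)[OF k(1)] by (simp add: m_assoc eps_central)
    then have "\<rho> (c (k \<lhd>\<^bsub>K\<^esub> r)) = \<rho> (c k \<otimes> r)"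
      using k by (intro \<rho>_eq) (simp_all add: c(1) f_c d_ract dk K.ract_closed m_assoc)
    then show "h (k \<lhd>\<^bsub>K\<^esub> r) = h k \<lhd>\<^bsub>U\<^esub> r"
      using k by (simp add: h_def c(1) \<rho>_ract)
  qed
  have U_eps: "u \<lhd>\<^bsub>U\<^esub> \<epsilon> = \<zero>\<^bsub>U\<^esub>" if u: "u \<in> carrier U" for u
  proof -
    obtain r where r: "r \<in> carrier C" "u = \<rho> r"
      using u presents_surj[OF U] by auto
    have "\<epsilon> \<otimes> f \<otimes> (r \<otimes> \<epsilon>) = \<zero>"
      using r(1) by (simp add: m_assoc eps_central)
    then show ?thesis
      using r presents_kernel[OF U, of "r \<otimes> \<epsilon>"] by (simp add: I\<^sub>U_def flip: \<rho>_ract)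
  qed
  have eps: "\<epsilon> \<in> I\<^sub>U"
    by (simp add: I\<^sub>U_def m_assoc eps_central[of f, symmetric] flip: m_assoc[of \<epsilon> \<epsilon>])
  \<comment> \<open>Dividing the f-part of \<open>\<epsilon>\<close> by \<epsilon> gives a
    representative of the generator of \<open>U\<close>; \<open>b\<close> carries
    \<open>\<epsilon>\<close> into the given syzygy.\<close>
  define m where "m = b \<epsilon>"
  have m: "m \<in> carrier K"
    using b[OF _ eps] by (simp add: m_def)
  have m_eps: "m \<lhd>\<^bsub>K\<^esub> \<epsilon> = \<zero>\<^bsub>K\<^esub>"
  proof -
    have "m \<lhd>\<^bsub>K\<^esub> \<epsilon> = b (\<epsilon> \<otimes> \<zero>)"
      using b_ract[OF _ eps, of \<epsilon>] by (simp add: m_def)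
    also have "\<dots> = \<zero>\<^bsub>K\<^esub>"
      using b_ract[OF _ eps, of \<zero>] b[OF _ eps] by (simp add: K.ract_zero)
    finally show ?thesis .
  qed
  have "h m = \<rho> \<one>"
  proof -
    \<comment> \<open>Passing to \<open>K\<close> and back multiplies by \<open>y\<close>, which is
      \<open>\<one>\<close> modulo \<open>I\<^sub>U\<close>. This difference is invisible after
      multiplication by \<open>\<epsilon> \<otimes> f\<close>.\<close>
    obtain y where y: "y \<in> carrier C" "y \<ominus> \<one> \<in> I\<^sub>U" "d (i m) = y \<otimes> \<epsilon>"
      using db[OF _ eps] unfolding m_def by auto
    have "f \<otimes> (y \<otimes> \<epsilon>) = f \<otimes> (\<one> \<otimes> \<epsilon>)"
    proof -
      have "\<epsilon> \<otimes> f \<otimes> (y \<ominus> \<one>) = \<zero>"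
        using y(2) by (simp add: I\<^sub>U_def)
      then have "f \<otimes> (y \<otimes> \<epsilon>) \<ominus> f \<otimes> (\<one> \<otimes> \<epsilon>) = \<zero>"
        using y(1) by (simp add: minus_eq r_distr r_minus eps_central m_assoc)
      then show ?thesis
        using y(1) by (simp add: minus_eq_zero_iff)
    qed
    then show ?thesis
      unfolding h_def using y f_c[OF m] c(1)[OF m] by (intro \<rho>_eq) simp_all
  qed
  moreover have "\<rho> \<one> \<noteq> \<zero>\<^bsub>U\<^esub>"
    using eps_f_nonzero presents_kernel[OF U, of \<one>] by (simp add: I\<^sub>U_def)
  ultimately have hm: "h m \<noteq> \<zero>\<^bsub>U\<^esub>" by simp
  define h' where "h' = restrict h (carrier K)"
  have "\<not> null_hom C K U h'"
  proof
    assume "null_hom C K U h'"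
    then obtain P' :: "('c, 'u) rmodule" and u v where P': "P' \<in> fg_modules C" "projective C P'" and u: "rlin C K P' u"
      and v: "rlin C P' U v" and huv: "\<And>x. x \<in> carrier K \<Longrightarrow> h' x = v (u x)"
      by (rule null_homE) blast
    have P'_mod: "right_module C P'" using P'(2) by (simp add: projective_def)
    have "u m \<lhd>\<^bsub>P'\<^esub> \<epsilon> = \<zero>\<^bsub>P'\<^esub>"
      using rlin_ract[OF u m, of \<epsilon>] m_eps rlin_zero[OF K P'_mod u] by simp
    then obtain q where q: "q \<in> carrier P'" "u m = q \<lhd>\<^bsub>P'\<^esub> \<epsilon>"
      using projective_eps_annihilator[OF inf P'(2,1) rlin_closed[OF u m]] by metis
    have "h m = v q \<lhd>\<^bsub>U\<^esub> \<epsilon>"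
      using huv[OF m] q m rlin_ract[OF v q(1), of \<epsilon>] by (simp add: h'_def)
    then show False
      using hm U_eps rlin_closed[OF v q(1)] by simp
  qed
  then show ?thesis
    using rhom_restrict[OF K h] unfolding h'_def by blast
qed

subsection \<open>Morphisms out of \<open>U\<close>\<close>

text \<open>The aim is to divide the image \<open>z\<close> of the generator by \<epsilon>, since
  the map then factors through the regular module. Nullity on Q writes \<open>z\<close> as an
  \<epsilon>-multiple plus the image of some \<open>t\<close> under the arrow; nullity on V divides
  \<open>t\<close> by \<epsilon>.\<close>

lemma hom_U_null:
  fixes U V Q R Y :: "('c, 'u) rmodule"
  assumes inf: "infinite (UNIV :: 'u set)" and U: "presents C I\<^sub>U U \<rho>\<^sub>U" and V: "presents C I\<^sub>V V \<rho>\<^sub>V"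
    and Q: "presents C I\<^sub>Q Q \<rho>\<^sub>Q" and R: "presents C {\<zero>} R \<rho>\<^sub>R" and Y: "right_module C Y"
    and null_V: "\<And>h. h \<in> rhom C V Y \<Longrightarrow> null_hom C V Y h"
    and null_Q: "\<And>h. h \<in> rhom C Q Y \<Longrightarrow> null_hom C Q Y h"
    and g: "rlin C U Y g"
  shows "null_hom C U Y g"
proof -
  interpret Y: right_module C Y by fact
  have one_mem: "\<rho> \<one> \<in> carrier X" if "presents C I X \<rho>" for I \<rho> and X :: "('c, 'u) rmodule"
    using presents_surj[OF that] by auto
  define z where "z = g (\<rho>\<^sub>U \<one>)"
  have z: "z \<in> carrier Y"
    unfolding z_def using rlin_closed[OF g one_mem[OF U]] .
  have g_eq: "g (\<rho>\<^sub>U r) = z \<lhd>\<^bsub>Y\<^esub> r" if "r \<in> carrier C" for r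
    unfolding z_def by (rule presents_hom[OF U g that])
  have z_I: "z \<lhd>\<^bsub>Y\<^esub> r = \<zero>\<^bsub>Y\<^esub>" if "r \<in> carrier C" "\<epsilon> \<otimes> f \<otimes> r = \<zero>" for r
    using that g_eq[OF that(1)] presents_kernel[OF U that(1)] rlin_zero[OF presents_module[OF U] Y g]
    by (simp add: I\<^sub>U_def)
  have z_e: "z \<lhd>\<^bsub>Y\<^esub> e = \<zero>\<^bsub>Y\<^esub>"
    by (rule z_I) (simp_all add: m_assoc)
  have z_f: "z \<lhd>\<^bsub>Y\<^esub> f = z"
    using Y.ract_add_right[OF z closed(1,2)] z_e z by (simp add: Y.ract_one Y.ract_closed flip: one_eq)
  have z_w: "z \<lhd>\<^bsub>Y\<^esub> w = \<zero>\<^bsub>Y\<^esub>"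
  proof (rule z_I)
    have "f \<otimes> a = f \<otimes> e \<otimes> a"
      by (subst m_assoc) simp_all
    then have "f \<otimes> a = \<zero>"
      by simp
    then have "f \<otimes> w = \<ominus> (f \<otimes> (f \<otimes> \<epsilon>))"
      by (simp add: w_def minus_eq r_distr r_minus eps_central)
    then have "\<epsilon> \<otimes> (f \<otimes> w) = \<zero>"
      by (simp add: r_minus m_assoc eps_central)
    then show "\<epsilon> \<otimes> f \<otimes> w = \<zero>"
      by (simp add: m_assoc)
  qed simp
  \<comment> \<open>This is \<open>g\<close> preceded by the surjection Q \<rightarrow> U; it is
    well defined because \<open>z\<close> is killed by \<open>w\<close>.\<close>
  obtain h where h: "h \<in> rhom C Q Y" "\<And>r. r \<in> carrier C \<Longrightarrow> h (\<rho>\<^sub>Q r) = z \<lhd>\<^bsub>Y\<^esub> r"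
  proof (rule presents_induced[OF Q Y z])
    fix r assume "r \<in> I\<^sub>Q"
    then obtain t where "t \<in> carrier C" "r = w \<otimes> t" by (auto simp: I\<^sub>Q_def)
    then show "z \<lhd>\<^bsub>Y\<^esub> r = \<zero>\<^bsub>Y\<^esub>"
      using z z_w by (simp add: Y.ract_mult Y.zero_ract)
  qed blast
  obtain P :: "('c, 'u) rmodule" and u v where P: "P \<in> fg_modules C" "projective C P" and u: "rlin C Q P u"
    and v: "rlin C P Y v" and huv: "\<And>x. x \<in> carrier Q \<Longrightarrow> h x = v (u x)"
    by (rule null_homE[OF null_Q[OF h(1)]]) blast
  interpret P: right_module C P using P(2) by (simp add: projective_def)
  define y where "y = u (\<rho>\<^sub>Q \<one>)"
  have y: "y \<in> carrier P"
    unfolding y_def using rlin_closed[OF u one_mem[OF Q]] .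
  have v_y: "v y = z"
    unfolding y_def using huv[OF one_mem[OF Q]] h(2)[of \<one>] z by (simp add: Y.ract_one)
  have "w \<in> I\<^sub>Q"
    by (auto simp: I\<^sub>Q_def intro!: exI[of _ \<one>])
  then have "y \<lhd>\<^bsub>P\<^esub> w = \<zero>\<^bsub>P\<^esub>"
    unfolding y_def
    using presents_hom[OF Q u w_closed] presents_kernel[OF Q w_closed]
      rlin_zero[OF presents_module[OF Q] P.right_module_axioms u] by simp
  then have "y \<lhd>\<^bsub>P\<^esub> a = y \<lhd>\<^bsub>P\<^esub> (\<epsilon> \<otimes> f)"
    using y by (simp add: w_def P.ract_minus_right P.M.minus_eq_zero_iff P.ract_closed)
  then obtain x x' where x: "x \<in> carrier P" "x' \<in> carrier P"
    "y \<lhd>\<^bsub>P\<^esub> f = x \<lhd>\<^bsub>P\<^esub> a \<oplus>\<^bsub>P\<^esub> x' \<lhd>\<^bsub>P\<^esub> \<epsilon>" "y \<lhd>\<^bsub>P\<^esub> e = x \<lhd>\<^bsub>P\<^esub> \<epsilon>"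
    using projective_a_eps_f_annihilator[OF inf P(2,1) y] by metis
  note v_closed = rlin_closed[OF v] and v_ract = rlin_ract[OF v] and v_add = rlin_add[OF v]
  \<comment> \<open>The second summand is already a multiple of \<epsilon>. The first is the part of
    the morphism that factors over U \<rightarrow> V.\<close>
  have z_eq: "z = v x \<lhd>\<^bsub>Y\<^esub> a \<oplus>\<^bsub>Y\<^esub> v x' \<lhd>\<^bsub>Y\<^esub> \<epsilon>"
  proof -
    have "z = v (y \<lhd>\<^bsub>P\<^esub> f)"
      using v_ract[OF y closed(2)] v_y z_f by simp
    then show ?thesis
      using x by (simp add: v_add v_ract P.ract_closed)
  qed
  \<comment> \<open>The e-part of the description of \<open>y\<close> enters here: \<open>v\<close>
    maps \<open>y \<lhd> e\<close> to \<open>z \<lhd> e\<close>, which is zero. Hence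
    \<open>t\<close> below is a possible image of the generator of V.\<close>
  have vx_eps: "v x \<lhd>\<^bsub>Y\<^esub> \<epsilon> = \<zero>\<^bsub>Y\<^esub>"
    using v_ract[OF y closed(1)] v_ract[OF x(1) closed(4)] x(4) v_y z_e by simp
  define t where "t = v x \<lhd>\<^bsub>Y\<^esub> e"
  have t: "t \<in> carrier Y"
    unfolding t_def using v_closed[OF x(1)] by (simp add: Y.ract_closed)
  obtain k where k: "k \<in> rhom C V Y" "\<And>r. r \<in> carrier C \<Longrightarrow> k (\<rho>\<^sub>V r) = t \<lhd>\<^bsub>Y\<^esub> r"
  proof (rule presents_induced[OF V Y t])
    fix r assume r: "r \<in> carrier C" "r \<in> I\<^sub>V"
    then obtain t' where t': "t' \<in> carrier C" "e \<otimes> r = t' \<otimes> \<epsilon>"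
      using eps_e_mult_eq_zero[of r] by (auto simp: I\<^sub>V_def)
    have "t \<lhd>\<^bsub>Y\<^esub> r = v x \<lhd>\<^bsub>Y\<^esub> (\<epsilon> \<otimes> t')"
      unfolding t_def using v_closed[OF x(1)] r(1) t' by (simp add: eps_central flip: Y.ract_mult)
    then show "t \<lhd>\<^bsub>Y\<^esub> r = \<zero>\<^bsub>Y\<^esub>"
      using v_closed[OF x(1)] t'(1) vx_eps by (simp add: Y.ract_mult Y.zero_ract)
  qed blast
  obtain P' :: "('c, 'u) rmodule" and u' v' where P': "P' \<in> fg_modules C" "projective C P'" and u': "rlin C V P' u'"
    and v': "rlin C P' Y v'" and kuv: "\<And>x. x \<in> carrier V \<Longrightarrow> k x = v' (u' x)"
    by (rule null_homE[OF null_V[OF k(1)]]) blast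
  have P'_mod: "right_module C P'" using P'(2) by (simp add: projective_def)
  define q where "q = u' (\<rho>\<^sub>V \<one>)"
  have q: "q \<in> carrier P'"
    unfolding q_def using rlin_closed[OF u' one_mem[OF V]] .
  have v'_q: "v' q = t"
    unfolding q_def using kuv[OF one_mem[OF V]] k(2)[of \<one>] t by (simp add: Y.ract_one)
  have "\<epsilon> \<in> I\<^sub>V"
    by (simp add: I\<^sub>V_def m_assoc eps_central[of e, symmetric] flip: m_assoc[of \<epsilon> \<epsilon>])
  then have "q \<lhd>\<^bsub>P'\<^esub> \<epsilon> = \<zero>\<^bsub>P'\<^esub>"
    unfolding q_def using presents_hom[OF V u' closed(4)] presents_kernel[OF V closed(4)]
      rlin_zero[OF presents_module[OF V] P'_mod u'] by simp
  then obtain q' where q': "q' \<in> carrier P'" "q = q' \<lhd>\<^bsub>P'\<^esub> \<epsilon>"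
    using projective_eps_annihilator[OF inf P'(2,1) q] by metis
  \<comment> \<open>Both summands of \<open>z\<close> divided by \<epsilon>: \<open>t\<close> equals
    \<open>v' q' \<lhd> \<epsilon>\<close>, and \<epsilon> commutes with the arrow.\<close>
  define z' where "z' = v' q' \<lhd>\<^bsub>Y\<^esub> a \<oplus>\<^bsub>Y\<^esub> v x'"
  have v'q': "v' q' \<in> carrier Y"
    using rlin_closed[OF v' q'(1)] .
  have z': "z' \<in> carrier Y"
    unfolding z'_def using v'q' v_closed[OF x(2)] by (simp add: Y.ract_closed)
  have "t = v' q' \<lhd>\<^bsub>Y\<^esub> \<epsilon>"
    using v'_q q' rlin_ract[OF v' q'(1), of \<epsilon>] by simp
  moreover have "v x \<lhd>\<^bsub>Y\<^esub> a = t \<lhd>\<^bsub>Y\<^esub> a"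
    unfolding t_def using v_closed[OF x(1)] by (simp flip: Y.ract_mult)
  ultimately have "z = z' \<lhd>\<^bsub>Y\<^esub> \<epsilon>"
    using z_eq v'q' v_closed[OF x(2)]
    by (simp add: z'_def Y.ract_add_left Y.ract_closed eps_central flip: Y.ract_mult)
  then have z_fac: "z \<lhd>\<^bsub>Y\<^esub> r = z' \<lhd>\<^bsub>Y\<^esub> (\<epsilon> \<otimes> f \<otimes> r)" if "r \<in> carrier C" for r
    using z_f z z' that by (metis Y.ract_mult closed(2,4) m_closed)
  interpret R: right_module C R using presents_module[OF R] .
  have R1: "\<rho>\<^sub>R \<one> \<lhd>\<^bsub>R\<^esub> (\<epsilon> \<otimes> f) \<in> carrier R"
    using one_mem[OF R] by (simp add: R.ract_closed)
  \<comment> \<open>U is embedded into the regular module as \<open>\<epsilon> f C\<close>; the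
    generator goes to \<open>\<epsilon> f\<close> and from there to
    \<open>z' \<lhd> (\<epsilon> \<otimes> f)\<close>, which is \<open>z\<close>.\<close>
  obtain u1 where u1: "u1 \<in> rhom C U R"
    "\<And>r. r \<in> carrier C \<Longrightarrow> u1 (\<rho>\<^sub>U r) = \<rho>\<^sub>R \<one> \<lhd>\<^bsub>R\<^esub> (\<epsilon> \<otimes> f) \<lhd>\<^bsub>R\<^esub> r"
  proof (rule presents_induced[OF U R.right_module_axioms R1])
    fix r assume r: "r \<in> carrier C" "r \<in> I\<^sub>U"
    then show "\<rho>\<^sub>R \<one> \<lhd>\<^bsub>R\<^esub> (\<epsilon> \<otimes> f) \<lhd>\<^bsub>R\<^esub> r = \<zero>\<^bsub>R\<^esub>"
      using one_mem[OF R] by (simp add: I\<^sub>U_def R.ract_zero flip: R.ract_mult)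
  qed blast
  obtain v1 where v1: "v1 \<in> rhom C R Y" "\<And>r. r \<in> carrier C \<Longrightarrow> v1 (\<rho>\<^sub>R r) = z' \<lhd>\<^bsub>Y\<^esub> r"
    using presents_induced[OF R Y z'] Y.ract_zero[OF z'] by (metis singletonD)
  show ?thesis
  proof (rule null_homI[OF presents_module[OF U] presents_fg[OF R fin] presents_zero_projective[OF R]
        rlin_if_rhom[OF u1(1)] rlin_if_rhom[OF v1(1)]])
    fix x assume "x \<in> carrier U"
    then obtain r where r: "r \<in> carrier C" "x = \<rho>\<^sub>U r"
      using presents_surj[OF U] by auto
    have "u1 x = \<rho>\<^sub>R (\<epsilon> \<otimes> f \<otimes> r)"
      using r u1(2)[OF r(1)] one_mem[OF R] presents_one[OF R, of "\<epsilon> \<otimes> f \<otimes> r"]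
      by (simp flip: R.ract_mult)
    then show "g x = v1 (u1 x)"
      using r v1(2)[of "\<epsilon> \<otimes> f \<otimes> r"] g_eq[OF r(1)] z_fac[OF r(1)] by simp
  qed
qed

section \<open>The adjunction evaluated on the test modules\<close>

theorem no_right_adjoint:
  fixes \<Omega> :: "(('c, 'u) rmodule, ('u \<Rightarrow> 'u) set, ('c, 'u) rmodule, ('u \<Rightarrow> 'u) set) cat_map"
  assumes inf: "infinite (UNIV :: 'u set)" and \<Omega>: "heller_operator C \<Omega>"
  shows "\<not> has_right_adjoint (stable_cat C) (stable_cat C) \<Omega>"
proof
  assume "has_right_adjoint (stable_cat C) (stable_cat C) \<Omega>"
  then obtain G where G: "is_right_adjoint (stable_cat C) (stable_cat C) \<Omega> G"
    by (auto simp: has_right_adjoint_def)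
  obtain U :: "('c, 'u) rmodule" and \<rho>\<^sub>U where U: "presents C I\<^sub>U U \<rho>\<^sub>U"
    by (rule ex_presents[OF ring_axioms fin inf rsubmodule_I\<^sub>U])
  obtain V :: "('c, 'u) rmodule" and \<rho>\<^sub>V where V: "presents C I\<^sub>V V \<rho>\<^sub>V"
    by (rule ex_presents[OF ring_axioms fin inf rsubmodule_I\<^sub>V])
  obtain Q :: "('c, 'u) rmodule" and \<rho>\<^sub>Q where Q: "presents C I\<^sub>Q Q \<rho>\<^sub>Q"
    by (rule ex_presents[OF ring_axioms fin inf rsubmodule_I\<^sub>Q])
  have "rsubmodule C {\<zero>} (regular_module C)"
    by (simp add: rsubmodule_def)
  then obtain R :: "('c, 'u) rmodule" and \<rho>\<^sub>R where R: "presents C {\<zero>} R \<rho>\<^sub>R"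
    using ex_presents[OF ring_axioms fin inf] by blast
  note fgs = presents_fg[OF U fin] presents_fg[OF V fin] presents_fg[OF Q fin]
  obtain P i p where heller: "\<And>X. X \<in> fg_modules C \<Longrightarrow>
      on_obj \<Omega> X \<in> fg_modules C \<and> P X \<in> fg_modules C \<and> projective C (P X) \<and>
      short_exact C (on_obj \<Omega> X) (P X) X (i X) (p X)"
    using \<Omega> unfolding heller_operator_def by blast
  have mod: "right_module C X" if "X \<in> fg_modules C" for X :: "('c, 'u) rmodule"
    using that by (simp add: fg_modules_def)
  define Y where "Y = on_obj G U"
  have Y_fg: "Y \<in> fg_modules C"
    using G fgs(1) by (auto simp: Y_def is_right_adjoint_def is_functor_def stable_cat_def)
  note singleton_iff = is_singleton_stable_hom_iff[OF _ _ presents_fg[OF R fin] presents_zero_projective[OF R]]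
  have null_iff: "(\<forall>h\<in>rhom C X Y. null_hom C X Y h) \<longleftrightarrow> (\<forall>h\<in>rhom C (on_obj \<Omega> X) U. null_hom C (on_obj \<Omega> X) U h)"
    if X: "X \<in> fg_modules C" for X
    using right_adjoint_is_singleton_iff[OF G, of X U] X fgs(1) heller[OF X]
      singleton_iff[OF mod[OF X] mod[OF Y_fg]] singleton_iff[of "on_obj \<Omega> X" U] mod
    by (simp add: Y_def stable_cat_def)
  \<comment> \<open>No path leads from f back to e, so \<open>f C e = 0\<close> and the e-part of
    \<open>U\<close> vanishes.\<close>
  have U_e: "u \<lhd>\<^bsub>U\<^esub> e = \<zero>\<^bsub>U\<^esub>" if u: "u \<in> carrier U" for u
  proof -
    obtain r where r: "r \<in> carrier C" "u = \<rho>\<^sub>U r"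
      using u presents_surj[OF U] by auto
    have "\<epsilon> \<otimes> f \<otimes> (r \<otimes> e) = \<epsilon> \<otimes> (f \<otimes> r \<otimes> e)"
      using r(1) by (simp add: m_assoc)
    then show ?thesis
      using r no_f_e[OF r(1)] presents_kernel[OF U, of "r \<otimes> e"] rlin_ract[OF presents_rlin[OF U], of r e]
      by (simp add: I\<^sub>U_def)
  qed
  have null_V: "\<forall>h\<in>rhom C V Y. null_hom C V Y h"
    using null_iff[OF fgs(2)] hom_syzygy_V_null[OF inf V _ _ _ _ presents_module[OF U] U_e]
      heller[OF fgs(2)] mod rlin_if_rhom by metis
  have null_Q: "\<forall>h\<in>rhom C Q Y. null_hom C Q Y h"
  proof -
    define K where "K = on_obj \<Omega> Q"
    have K: "K \<in> fg_modules C" and K_mod: "right_module C K" and K_proj: "projective C K"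
      using heller[OF fgs(3)] mod syzygy_Q_projective[OF inf Q] by (auto simp: K_def)
    \<comment> \<open>A morphism out of a projective module factors over its own source.\<close>
    have "rlin C K K (\<lambda>x. x)"
      by (intro rlinI) auto
    then have "null_hom C K U h" if "h \<in> rhom C K U" for h
      using null_homI[OF K_mod K K_proj _ rlin_if_rhom[OF that]] by simp
    then show ?thesis
      using null_iff[OF fgs(3)] by (simp add: K_def)
  qed
  have "null_hom C U Y h" if "h \<in> rhom C U Y" for h
    using null_V null_Q by (intro hom_U_null[OF inf U V Q R mod[OF Y_fg]] rlin_if_rhom[OF that]) auto
  then have "\<forall>h\<in>rhom C (on_obj \<Omega> U) U. null_hom C (on_obj \<Omega> U) U h"
    using null_iff[OF fgs(1)] by simp
  then show False
    using ex_hom_syzygy_U_not_null[OF inf U, of "P U" "on_obj \<Omega> U" "i U" "p U"] heller[OF fgs(1)] mod by blast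
qed

end

section \<open>The ring \<open>C\<^sub>3\<close>\<close>

text \<open>All claims come from cancelling \<open>x\<close> in the domain: \<open>x = s x^2\<close>
  would make \<open>x\<close> a unit, and \<open>r x = s x^2\<close> forces
  \<open>r = s x\<close>.\<close>

lemma (in domain) quotient_by_square:
  assumes x: "x \<in> carrier R" "x \<noteq> \<zero>" "x \<notin> Units R"
  defines "I \<equiv> PIdl (x \<otimes> x)"
  shows "cring (R Quot I)" and "I +> x \<in> carrier (R Quot I)"
    and "I +> x \<noteq> \<zero>\<^bsub>R Quot I\<^esub>"
    and "(I +> x) \<otimes>\<^bsub>R Quot I\<^esub> (I +> x) = \<zero>\<^bsub>R Quot I\<^esub>"
    and "\<And>y. \<lbrakk>y \<in> carrier (R Quot I); y \<otimes>\<^bsub>R Quot I\<^esub> (I +> x) = \<zero>\<^bsub>R Quot I\<^esub>\<rbrakk>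
      \<Longrightarrow> \<exists>t\<in>carrier (R Quot I). y = t \<otimes>\<^bsub>R Quot I\<^esub> (I +> x)"
proof -
  interpret ideal I R
    unfolding I_def using x(1) by (intro cgenideal_ideal) simp
  have coset_zero: "I +> r = \<zero>\<^bsub>R Quot I\<^esub> \<longleftrightarrow> r \<in> I" if "r \<in> carrier R" for r
    using that rcos_const_imp_mem a_rcos_const by (auto simp: FactRing_def)
  have mult: "(I +> r) \<otimes>\<^bsub>R Quot I\<^esub> (I +> s) = I +> (r \<otimes> s)" if "r \<in> carrier R" "s \<in> carrier R" for r s
    using that by (simp add: FactRing_def rcoset_mult_add)
  have carrier_iff: "y \<in> carrier (R Quot I) \<longleftrightarrow> (\<exists>r\<in>carrier R. y = I +> r)" for y
    by (auto simp: FactRing_def A_RCOSETS_def')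
  have mem_I: "r \<in> I \<longleftrightarrow> (\<exists>s\<in>carrier R. r = s \<otimes> (x \<otimes> x))" for r
    unfolding I_def cgenideal_def by blast
  show "cring (R Quot I)"
    by (rule quotient_is_cring) (rule is_cring)
  show "I +> x \<in> carrier (R Quot I)"
    using x(1) carrier_iff by blast
  show "I +> x \<noteq> \<zero>\<^bsub>R Quot I\<^esub>"
  proof
    assume "I +> x = \<zero>\<^bsub>R Quot I\<^esub>"
    then obtain s where s: "s \<in> carrier R" "x = s \<otimes> (x \<otimes> x)"
      using x(1) coset_zero mem_I by auto
    then have "\<one> \<otimes> x = (s \<otimes> x) \<otimes> x"
      using x(1) by (simp add: m_assoc)
    then have "s \<otimes> x = \<one>"
      using x s(1) m_rcancel[of x \<one> "s \<otimes> x"] by auto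
    then show False
      using x s(1) by (auto simp: Units_def m_comm)
  qed
  show "(I +> x) \<otimes>\<^bsub>R Quot I\<^esub> (I +> x) = \<zero>\<^bsub>R Quot I\<^esub>"
    using x(1) by (auto simp: mult coset_zero mem_I intro!: bexI[of _ \<one>])
  fix y assume y: "y \<in> carrier (R Quot I)" "y \<otimes>\<^bsub>R Quot I\<^esub> (I +> x) = \<zero>\<^bsub>R Quot I\<^esub>"
  then obtain r where r: "r \<in> carrier R" "y = I +> r"
    using carrier_iff by blast
  then obtain s where s: "s \<in> carrier R" "r \<otimes> x = s \<otimes> (x \<otimes> x)"
    using y(2) x(1) by (auto simp: mult coset_zero mem_I)
  then have "r \<otimes> x = (s \<otimes> x) \<otimes> x"
    using x(1) by (simp add: m_assoc)
  then have "r = s \<otimes> x"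
    using x r(1) s(1) m_rcancel[of x r "s \<otimes> x"] by auto
  then show "\<exists>t\<in>carrier (R Quot I). y = t \<otimes>\<^bsub>R Quot I\<^esub> (I +> x)"
    using r s(1) x(1) carrier_iff by (auto simp: mult intro!: bexI[of _ "I +> s"])
qed

lemma ring_R_mod_pi2_facts:
  obtains \<epsilon> where "cring ring_R_mod_pi2" and "finite (carrier ring_R_mod_pi2)"
    and "\<epsilon> \<in> carrier ring_R_mod_pi2" and "\<epsilon> \<noteq> \<zero>\<^bsub>ring_R_mod_pi2\<^esub>"
    and "\<epsilon> \<otimes>\<^bsub>ring_R_mod_pi2\<^esub> \<epsilon> = \<zero>\<^bsub>ring_R_mod_pi2\<^esub>"
    and "\<And>y. \<lbrakk>y \<in> carrier ring_R_mod_pi2; y \<otimes>\<^bsub>ring_R_mod_pi2\<^esub> \<epsilon> = \<zero>\<^bsub>ring_R_mod_pi2\<^esub>\<rbrakk>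
      \<Longrightarrow> \<exists>t\<in>carrier ring_R_mod_pi2. y = t \<otimes>\<^bsub>ring_R_mod_pi2\<^esub> \<epsilon>"
proof -
  define F where "F = residue_ring 3"
  have prime: "residues_prime 3"
    by (rule residues_prime.intro) simp
  interpret F: field F
    using residues_prime.is_field[OF prime] by (simp add: F_def)
  have subring: "subring (carrier F) F" and subfield: "subfield (carrier F) F"
    by (rule F.carrier_is_subring, rule F.carrier_is_subfield)
  have R: "ring_R = univ_poly F (carrier F)" and pi: "elem_pi = [\<one>\<^bsub>F\<^esub>, \<zero>\<^bsub>F\<^esub>]"
    by (simp_all add: ring_R_def elem_pi_def var_def F_def)
  interpret R: domain ring_R
    unfolding R by (rule F.univ_poly_is_domain[OF subring])
  have pi_closed: "elem_pi \<in> carrier ring_R"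
    using F.var_closed(1)[OF subring] unfolding R pi var_def .
  have pi_nonzero: "elem_pi \<noteq> \<zero>\<^bsub>ring_R\<^esub>"
    by (simp add: R pi univ_poly_zero)
  \<comment> \<open>Over a field the units are the nonzero constants, that is, lists of length one,
    whereas \<open>elem_pi\<close> has length two.\<close>
  have pi_nonunit: "elem_pi \<notin> Units ring_R"
    unfolding R F.univ_poly_units[OF subfield] by (simp add: pi)
  have square: "elem_pi [^]\<^bsub>ring_R\<^esub> (2::nat) = elem_pi \<otimes>\<^bsub>ring_R\<^esub> elem_pi"
    using pi_closed by (simp add: numeral_2_eq_2)
  define I where "I = PIdl\<^bsub>ring_R\<^esub> (elem_pi \<otimes>\<^bsub>ring_R\<^esub> elem_pi)"
  have K: "ring_R_mod_pi2 = ring_R Quot I"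
    by (simp add: ring_R_mod_pi2_def I_def square)
  interpret I: ideal I ring_R
    unfolding I_def using pi_closed by (intro R.cgenideal_ideal) simp
  \<comment> \<open>Finiteness by division with remainder: every coset has a representative of
    degree below 2 over a finite field.\<close>
  have "carrier (ring_R Quot I) \<subseteq> (\<lambda>r. I +>\<^bsub>ring_R\<^esub> r) ` {r. set r \<subseteq> carrier F \<and> length r \<le> 2}"
  proof
    fix y assume "y \<in> carrier (ring_R Quot I)"
    then obtain p where p: "p \<in> carrier ring_R" "y = I +>\<^bsub>ring_R\<^esub> p"
      by (auto simp: FactRing_def A_RCOSETS_def')
    define b where "b = elem_pi \<otimes>\<^bsub>ring_R\<^esub> elem_pi"
    have b_closed: "b \<in> carrier ring_R"
      using pi_closed by (simp add: b_def)
    have b_nonzero: "b \<noteq> \<zero>\<^bsub>ring_R\<^esub>"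
      using pi_closed pi_nonzero by (simp add: b_def R.integral_iff)
    have "b = F.monom \<one>\<^bsub>F\<^esub> 2"
      using F.unitary_monom_eq_var_pow[OF subring, of 2] square
      unfolding R pi var_def b_def by simp
    then have b_degree: "degree b = 2"
      by (simp add: F.monom_def)
    obtain q r where qr: "q \<in> carrier ring_R" "r \<in> carrier ring_R" "p = b \<otimes>\<^bsub>ring_R\<^esub> q \<oplus>\<^bsub>ring_R\<^esub> r"
      "r = \<zero>\<^bsub>ring_R\<^esub> \<or> degree r < 2"
      using F.field_long_division_theorem_shell[OF subfield, folded R, OF p(1) b_closed b_nonzero] b_degree
      by auto
    have "b \<in> I"
      unfolding I_def b_def[symmetric] by (rule R.cgenideal_self[OF b_closed])
    then have "b \<otimes>\<^bsub>ring_R\<^esub> q \<in> I"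
      using qr(1) by (rule I.I_r_closed)
    then have "y = I +>\<^bsub>ring_R\<^esub> r"
      unfolding p(2) qr(3)
      using qr(2) I.a_subset by (simp add: R.a_coset_add_assoc[symmetric] I.a_rcos_const)
    moreover have "set r \<subseteq> carrier F"
      using qr(2) F.polynomial_incl unfolding R univ_poly_carrier[symmetric] by blast
    \<comment> \<open>Polynomials are coefficient lists, the zero polynomial is the empty list, and
      \<open>degree\<close> is the length minus one; degree below 2 thus means length at most
      2.\<close>
    moreover have "length r \<le> 2"
      using qr(4) by (auto simp: R univ_poly_zero)
    ultimately show "y \<in> (\<lambda>r. I +>\<^bsub>ring_R\<^esub> r) ` {r. set r \<subseteq> carrier F \<and> length r \<le> 2}"
      by blast
  qed
  moreover have "finite {r. set r \<subseteq> carrier F \<and> length r \<le> 2}"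
    by (rule finite_lists_length_le) (simp add: F_def residue_ring_def)
  ultimately have fin: "finite (carrier (ring_R Quot I))"
    using finite_surj by blast
  note facts = R.quotient_by_square[OF pi_closed pi_nonzero pi_nonunit, folded I_def]
  show thesis
    using that[of "I +>\<^bsub>ring_R\<^esub> elem_pi"] fin facts unfolding K by blast
qed

subsection \<open>The path algebra as a triangular matrix ring\<close>

text \<open>The upper triangular matrix with rows (x, y) and (0, z): the diagonal holds the
  coefficients at the trivial paths, the corner that of the arrow.\<close>

definition tri :: "('k, 'm) ring_scheme \<Rightarrow> 'k \<Rightarrow> 'k \<Rightarrow> 'k \<Rightarrow> vertex \<times> arrow list \<Rightarrow> 'k" where
  "tri K x y z = (\<lambda>p. if p = (Vertex_e, []) then x else if p = (Vertex_e, [Arrow_a]) then y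
     else if p = (Vertex_f, []) then z else \<zero>\<^bsub>K\<^esub>)"

lemma tri_eq_iff [simp]: "tri K x y z = tri K x' y' z' \<longleftrightarrow> x = x' \<and> y = y' \<and> z = z'"
  by (auto simp: tri_def dest: fun_cong[of _ _ "(Vertex_e, [])"]
      fun_cong[of _ _ "(Vertex_e, [Arrow_a])"] fun_cong[of _ _ "(Vertex_f, [])"])

text \<open>No arrow starts at f, so a path ends as soon as it has used the arrow.\<close>

lemma path_from_quiver_e_to_f:
  "path_from quiver_e_to_f v xs \<longleftrightarrow> (v, xs) \<in> {(Vertex_e, []), (Vertex_e, [Arrow_a]), (Vertex_f, [])}"
proof (cases xs)
  case Nil
  then show ?thesis by (cases v) (simp_all add: quiver_e_to_f_def)
next
  case (Cons x ys)
  have "x = Arrow_a" by (cases x)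
  moreover have "path_from quiver_e_to_f Vertex_f ys \<longleftrightarrow> ys = []"
    by (cases ys) (simp_all add: quiver_e_to_f_def)
  ultimately show ?thesis
    unfolding Cons by (cases v) (auto simp: quiver_e_to_f_def)
qed

lemma paths_quiver_e_to_f:
  "paths quiver_e_to_f = {(Vertex_e, []), (Vertex_e, [Arrow_a]), (Vertex_f, [])}"
  by (auto simp: paths_def path_from_quiver_e_to_f)

lemma path_splits_quiver_e_to_f:
  "path_splits quiver_e_to_f p =
    (if p = (Vertex_e, []) then {((Vertex_e, []), (Vertex_e, []))}
     else if p = (Vertex_e, [Arrow_a]) then
       {((Vertex_e, []), (Vertex_e, [Arrow_a])), ((Vertex_e, [Arrow_a]), (Vertex_f, []))}
     else if p = (Vertex_f, []) then {((Vertex_f, []), (Vertex_f, []))} else {})"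
  unfolding path_splits_def paths_quiver_e_to_f by (auto simp: quiver_e_to_f_def)

section \<open>Matrix arithmetic in the path algebra over a commutative ring\<close>

context cring
begin

abbreviation "T\<^sub>2 \<equiv> path_algebra R quiver_e_to_f"

lemma carrier_path_algebra:
  "carrier T\<^sub>2 = {tri R x y z | x y z. x \<in> carrier R \<and> y \<in> carrier R \<and> z \<in> carrier R}"
proof (intro equalityI subsetI)
  fix g assume g: "g \<in> carrier T\<^sub>2"
  have "g p = tri R (g (Vertex_e, [])) (g (Vertex_e, [Arrow_a])) (g (Vertex_f, [])) p" for p
    using g by (cases p) (auto simp: tri_def path_algebra_def paths_quiver_e_to_f)
  then have "g = tri R (g (Vertex_e, [])) (g (Vertex_e, [Arrow_a])) (g (Vertex_f, []))"
    by (rule ext)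
  moreover have "g p \<in> carrier R" for p
    using g by (cases p) (simp add: path_algebra_def)
  ultimately show "g \<in> {tri R x y z | x y z. x \<in> carrier R \<and> y \<in> carrier R \<and> z \<in> carrier R}"
    by blast
next
  fix g assume "g \<in> {tri R x y z | x y z. x \<in> carrier R \<and> y \<in> carrier R \<and> z \<in> carrier R}"
  then obtain x y z where g: "g = tri R x y z" "x \<in> carrier R" "y \<in> carrier R" "z \<in> carrier R"
    by blast
  have "{p. tri R x y z p \<noteq> \<zero>} \<subseteq> {(Vertex_e, []), (Vertex_e, [Arrow_a]), (Vertex_f, [])}"
    by (auto simp: tri_def)
  then have "finite {p. tri R x y z p \<noteq> \<zero>}"
    by (rule finite_subset) simp
  then show "g \<in> carrier T\<^sub>2"
    using g by (auto simp: path_algebra_def paths_quiver_e_to_f tri_def)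
qed

lemma path_algebra_zero: "\<zero>\<^bsub>T\<^sub>2\<^esub> = tri R \<zero> \<zero> \<zero>"
  by (auto simp: path_algebra_def tri_def)

lemma path_algebra_one: "\<one>\<^bsub>T\<^sub>2\<^esub> = tri R \<one> \<zero> \<one>"
  by (auto simp: path_algebra_def tri_def paths_quiver_e_to_f)

lemma path_algebra_add:
  "tri R x y z \<oplus>\<^bsub>T\<^sub>2\<^esub> tri R x' y' z' = tri R (x \<oplus> x') (y \<oplus> y') (z \<oplus> z')"
  by (auto simp: path_algebra_def tri_def)

lemma path_algebra_mult:
  assumes "x \<in> carrier R" "y \<in> carrier R" "z \<in> carrier R" "x' \<in> carrier R" "y' \<in> carrier R" "z' \<in> carrier R"
  shows "tri R x y z \<otimes>\<^bsub>T\<^sub>2\<^esub> tri R x' y' z' = tri R (x \<otimes> x') (x \<otimes> y' \<oplus> y \<otimes> z') (z \<otimes> z')"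
  using assms by (auto simp: path_algebra_def tri_def path_splits_quiver_e_to_f finsum_insert)

lemmas path_algebra_ops = path_algebra_zero path_algebra_one path_algebra_add path_algebra_mult

lemma ring_path_algebra: "ring T\<^sub>2"
proof (rule ringI)
  show "abelian_group T\<^sub>2"
  proof (rule abelian_groupI)
    fix g assume "g \<in> carrier T\<^sub>2"
    then obtain x y z where g: "g = tri R x y z" "x \<in> carrier R" "y \<in> carrier R" "z \<in> carrier R"
      by (auto simp: carrier_path_algebra)
    then have "tri R (\<ominus> x) (\<ominus> y) (\<ominus> z) \<in> carrier T\<^sub>2"
      "tri R (\<ominus> x) (\<ominus> y) (\<ominus> z) \<oplus>\<^bsub>T\<^sub>2\<^esub> g = \<zero>\<^bsub>T\<^sub>2\<^esub>"
      by (auto simp: carrier_path_algebra path_algebra_ops l_neg)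
    then show "\<exists>h\<in>carrier T\<^sub>2. h \<oplus>\<^bsub>T\<^sub>2\<^esub> g = \<zero>\<^bsub>T\<^sub>2\<^esub>"
      by blast
  qed (auto simp: carrier_path_algebra path_algebra_ops a_ac)
  show "monoid T\<^sub>2"
    by (rule monoidI) (auto simp: carrier_path_algebra path_algebra_ops m_assoc l_distr r_distr a_assoc)
qed (auto simp: carrier_path_algebra path_algebra_ops l_distr r_distr a_ac)

lemma finite_path_algebra:
  assumes "finite (carrier R)"
  shows "finite (carrier T\<^sub>2)"
proof -
  have "carrier T\<^sub>2 = (\<lambda>(x, y, z). tri R x y z) ` (carrier R \<times> carrier R \<times> carrier R)"
    by (auto simp: carrier_path_algebra image_iff)
  then show ?thesis
    using assms by simp
qed

text \<open>The nilpotent becomes a scalar matrix and is therefore central; the annihilator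
  conditions turn into conditions on the three coefficients.\<close>

lemma dual_number_path_ring_path_algebra:
  assumes fin: "finite (carrier R)" and \<epsilon>: "\<epsilon> \<in> carrier R" "\<epsilon> \<noteq> \<zero>" "\<epsilon> \<otimes> \<epsilon> = \<zero>"
    and ann: "\<And>y. \<lbrakk>y \<in> carrier R; y \<otimes> \<epsilon> = \<zero>\<rbrakk> \<Longrightarrow> \<exists>t\<in>carrier R. y = t \<otimes> \<epsilon>"
  shows "dual_number_path_ring T\<^sub>2 (tri R \<one> \<zero> \<zero>) (tri R \<zero> \<zero> \<one>) (tri R \<zero> \<one> \<zero>) (tri R \<epsilon> \<zero> \<epsilon>)"
    (is "dual_number_path_ring _ ?e ?f ?a ?\<epsilon>")
proof (intro dual_number_path_ring.intro ring_path_algebra dual_number_path_ring_axioms.intro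
    finite_path_algebra[OF fin])
  interpret A: ring T\<^sub>2 by (rule ring_path_algebra)
  have mem: "tri R x y z \<in> carrier T\<^sub>2" if "x \<in> carrier R" "y \<in> carrier R" "z \<in> carrier R" for x y z
    using that by (auto simp: carrier_path_algebra)
  show "\<exists>t\<in>carrier T\<^sub>2. g = t \<otimes>\<^bsub>T\<^sub>2\<^esub> ?\<epsilon>" if g: "g \<in> carrier T\<^sub>2" "g \<otimes>\<^bsub>T\<^sub>2\<^esub> ?\<epsilon> = \<zero>\<^bsub>T\<^sub>2\<^esub>" for g
  proof -
    obtain x y z where g_eq: "g = tri R x y z" and xyz: "x \<in> carrier R" "y \<in> carrier R" "z \<in> carrier R"
      using g(1) by (auto simp: carrier_path_algebra)
    have "x \<otimes> \<epsilon> = \<zero>" "y \<otimes> \<epsilon> = \<zero>" "z \<otimes> \<epsilon> = \<zero>"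
      using g(2) xyz \<epsilon>(1) by (simp_all add: g_eq path_algebra_ops)
    then obtain x' y' z' where "x' \<in> carrier R" "x = x' \<otimes> \<epsilon>" "y' \<in> carrier R" "y = y' \<otimes> \<epsilon>"
      "z' \<in> carrier R" "z = z' \<otimes> \<epsilon>"
      using ann xyz by metis
    then have "tri R x' y' z' \<in> carrier T\<^sub>2" "g = tri R x' y' z' \<otimes>\<^bsub>T\<^sub>2\<^esub> ?\<epsilon>"
      using \<epsilon>(1) by (auto simp: mem g_eq path_algebra_ops)
    then show ?thesis by blast
  qed
  show "\<exists>u\<in>carrier T\<^sub>2. \<exists>v\<in>carrier T\<^sub>2. g \<otimes>\<^bsub>T\<^sub>2\<^esub> ?f = u \<otimes>\<^bsub>T\<^sub>2\<^esub> ?a \<oplus>\<^bsub>T\<^sub>2\<^esub> v \<otimes>\<^bsub>T\<^sub>2\<^esub> ?\<epsilon> \<and> g \<otimes>\<^bsub>T\<^sub>2\<^esub> ?e = u \<otimes>\<^bsub>T\<^sub>2\<^esub> ?\<epsilon>"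
    if g: "g \<in> carrier T\<^sub>2" "g \<otimes>\<^bsub>T\<^sub>2\<^esub> ?a = g \<otimes>\<^bsub>T\<^sub>2\<^esub> (?\<epsilon> \<otimes>\<^bsub>T\<^sub>2\<^esub> ?f)" for g
  proof -
    obtain x y z where g_eq: "g = tri R x y z" and xyz: "x \<in> carrier R" "y \<in> carrier R" "z \<in> carrier R"
      using g(1) by (auto simp: carrier_path_algebra)
    \<comment> \<open>Coefficients at the arrow and at f: the left side of the equation is
      \<open>tri R \<zero> x \<zero>\<close>, the right side is \<open>tri R \<zero> (y \<otimes>
      \<epsilon>) (z \<otimes> \<epsilon>)\<close>.\<close>
    have x: "x = y \<otimes> \<epsilon>" and "z \<otimes> \<epsilon> = \<zero>"
      using g(2) xyz \<epsilon>(1) by (auto simp: g_eq path_algebra_ops)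
    then obtain z' where z': "z' \<in> carrier R" "z = z' \<otimes> \<epsilon>"
      using ann xyz by blast
    \<comment> \<open>The arrow coefficient \<open>y\<close> of \<open>g\<close>, moved to the
      vertex e, serves both equations, because \<open>x = y \<otimes> \<epsilon>\<close>.\<close>
    have "g \<otimes>\<^bsub>T\<^sub>2\<^esub> ?f = tri R y \<zero> \<zero> \<otimes>\<^bsub>T\<^sub>2\<^esub> ?a \<oplus>\<^bsub>T\<^sub>2\<^esub> tri R \<zero> \<zero> z' \<otimes>\<^bsub>T\<^sub>2\<^esub> ?\<epsilon>"
      and "g \<otimes>\<^bsub>T\<^sub>2\<^esub> ?e = tri R y \<zero> \<zero> \<otimes>\<^bsub>T\<^sub>2\<^esub> ?\<epsilon>"
      using xyz(2) \<epsilon>(1) z'(1) by (simp_all add: g_eq x z'(2) path_algebra_ops)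
    then show ?thesis
      using mem xyz(2) z'(1) zero_closed by blast
  qed
  show "?f \<otimes>\<^bsub>T\<^sub>2\<^esub> g = \<zero>\<^bsub>T\<^sub>2\<^esub>" if g: "g \<in> carrier T\<^sub>2" "(?a \<ominus>\<^bsub>T\<^sub>2\<^esub> ?\<epsilon> \<otimes>\<^bsub>T\<^sub>2\<^esub> ?f) \<otimes>\<^bsub>T\<^sub>2\<^esub> g = \<zero>\<^bsub>T\<^sub>2\<^esub>" for g
  proof -
    obtain x y z where g_eq: "g = tri R x y z" and xyz: "x \<in> carrier R" "y \<in> carrier R" "z \<in> carrier R"
      using g(1) by (auto simp: carrier_path_algebra)
    have "?a \<otimes>\<^bsub>T\<^sub>2\<^esub> g \<ominus>\<^bsub>T\<^sub>2\<^esub> (?\<epsilon> \<otimes>\<^bsub>T\<^sub>2\<^esub> ?f) \<otimes>\<^bsub>T\<^sub>2\<^esub> g = \<zero>\<^bsub>T\<^sub>2\<^esub>"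
      using g \<epsilon>(1) by (simp add: A.minus_eq A.l_distr A.l_minus mem)
    then have "?a \<otimes>\<^bsub>T\<^sub>2\<^esub> g = (?\<epsilon> \<otimes>\<^bsub>T\<^sub>2\<^esub> ?f) \<otimes>\<^bsub>T\<^sub>2\<^esub> g"
      using g(1) \<epsilon>(1) by (subst (asm) A.minus_eq_zero_iff) (simp_all add: mem)
    \<comment> \<open>The two products are supported on different paths, so their equality makes
      both vanish.\<close>
    moreover have "?a \<otimes>\<^bsub>T\<^sub>2\<^esub> g = tri R \<zero> z \<zero>" "(?\<epsilon> \<otimes>\<^bsub>T\<^sub>2\<^esub> ?f) \<otimes>\<^bsub>T\<^sub>2\<^esub> g = tri R \<zero> \<zero> (\<epsilon> \<otimes> z)"
      using xyz \<epsilon>(1) by (simp_all add: g_eq path_algebra_ops)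
    ultimately have "z = \<zero>"
      by (metis tri_eq_iff)
    then show ?thesis
      using xyz by (simp add: g_eq path_algebra_ops)
  qed
qed (use \<epsilon> in \<open>auto simp: carrier_path_algebra path_algebra_ops m_comm\<close>)

end

theorem mainTheorem5:
  fixes \<Omega> :: "((c3, 'u) rmodule, ('u \<Rightarrow> 'u) set, (c3, 'u) rmodule, ('u \<Rightarrow> 'u) set) cat_map"
  assumes "infinite (UNIV :: 'u set)"
    and "heller_operator C3 \<Omega>"
  shows "\<not> has_right_adjoint (stable_cat C3) (stable_cat C3) \<Omega>"
proof -
  obtain \<epsilon> where K: "cring ring_R_mod_pi2" "finite (carrier ring_R_mod_pi2)"
    and \<epsilon>: "\<epsilon> \<in> carrier ring_R_mod_pi2" "\<epsilon> \<noteq> \<zero>\<^bsub>ring_R_mod_pi2\<^esub>"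
      "\<epsilon> \<otimes>\<^bsub>ring_R_mod_pi2\<^esub> \<epsilon> = \<zero>\<^bsub>ring_R_mod_pi2\<^esub>"
      "\<And>y. \<lbrakk>y \<in> carrier ring_R_mod_pi2; y \<otimes>\<^bsub>ring_R_mod_pi2\<^esub> \<epsilon> = \<zero>\<^bsub>ring_R_mod_pi2\<^esub>\<rbrakk>
        \<Longrightarrow> \<exists>t\<in>carrier ring_R_mod_pi2. y = t \<otimes>\<^bsub>ring_R_mod_pi2\<^esub> \<epsilon>"
    by (rule ring_R_mod_pi2_facts) blast
  note path_ring = cring.dual_number_path_ring_path_algebra[OF K \<epsilon>]
  show ?thesis
    using dual_number_path_ring.no_right_adjoint[OF path_ring assms(1)] assms(2)
    unfolding C3_def by blast
qed

end
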